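(* Let $f\in H^\infty(\mathbb D)$. Then $f$ is an extreme point of the closed unit ball of $H^\infty(\mathbb D)$ if and only if $f(S_1)$ is an extreme point of the closed unit ball of $F_n^\infty$.
   Context: $F^2(H_n)$ is the full Fock space over an $n$-dimensional Hilbert space with basis $e_1,\dots,e_n$, and $S_1\psi=e_1\otimes\psi$ is the first left creation operator (a pure isometry). $F_n^\infty$ is the WOT-closed algebra generated by the left creation operators $S_1,\dots,S_n$ and the identity, with the operator norm. For $f\in H^\infty(\mathbb D)$, $f(S_1)\in F_n^\infty$ is given by the $H^\infty$ functional calculus of $S_1$, i.e. $f(S_1)=\mathrm{SOT}\text{-}\lim_{r\to1^-}f(rS_1)$. *)

theory Defs
  imports "HOL-Complex_Analysis.Complex_Analysis"
begin

type_synonym vec = "nat list \<Rightarrow> complex"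
type_synonym op = "vec \<Rightarrow> vec"

text \<open>Full Fock space over an n-dimensional Hilbert space: l2 over words in the
letters 0..n-1 (letter i corresponds to the basis vector e_(i+1); the empty word
is the vacuum). Vectors are functions on all lists, vanishing off the words.\<close>

definition words :: "nat \<Rightarrow> nat list set" where
  "words n = {w. \<forall>i\<in>set w. i < n}"

definition zero_vec :: vec where
  "zero_vec = (\<lambda>_. 0)"

definition l2 :: "nat \<Rightarrow> vec set" where
  "l2 n = {\<psi>. (\<forall>w. w \<notin> words n \<longrightarrow> \<psi> w = 0) \<and>
                (\<lambda>w. (cmod (\<psi> w))\<^sup>2) summable_on UNIV}"

definition l2norm :: "vec \<Rightarrow> real" where
  "l2norm \<psi> = sqrt (\<Sum>\<^sub>\<infinity>w. (cmod (\<psi> w))\<^sup>2)"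

definition l2inner :: "vec \<Rightarrow> vec \<Rightarrow> complex" where
  "l2inner \<psi> \<phi> = (\<Sum>\<^sub>\<infinity>w. \<psi> w * cnj (\<phi> w))"

text \<open>Operators are represented as maps vec => vec that are zero off l2 n.\<close>

definition bounded_op :: "nat \<Rightarrow> op \<Rightarrow> bool" where
  "bounded_op n T \<longleftrightarrow>
     (\<forall>\<psi>\<in>l2 n. T \<psi> \<in> l2 n) \<and>
     (\<forall>\<psi>\<in>l2 n. \<forall>\<phi>\<in>l2 n. \<forall>a b. T (\<lambda>w. a * \<psi> w + b * \<phi> w) = (\<lambda>w. a * T \<psi> w + b * T \<phi> w)) \<and>
     (\<exists>C. \<forall>\<psi>\<in>l2 n. l2norm (T \<psi>) \<le> C * l2norm \<psi>) \<and>
     (\<forall>\<psi>. \<psi> \<notin> l2 n \<longrightarrow> T \<psi> = zero_vec)"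

definition opnorm :: "nat \<Rightarrow> op \<Rightarrow> real" where
  "opnorm n T = Sup {l2norm (T \<psi>) | \<psi>. \<psi> \<in> l2 n \<and> l2norm \<psi> \<le> 1}"

definition id_op :: "nat \<Rightarrow> op" where
  "id_op n \<psi> = (if \<psi> \<in> l2 n then \<psi> else zero_vec)"

text \<open>Left creation operator S_(i+1): psi |-> e_(i+1) tensor psi.\<close>
definition creation :: "nat \<Rightarrow> nat \<Rightarrow> op" where
  "creation n i \<psi> = (if \<psi> \<in> l2 n then
      (\<lambda>w. case w of [] \<Rightarrow> 0 | j # v \<Rightarrow> if j = i then \<psi> v else 0)
    else zero_vec)"

inductive_set alg_gen :: "nat \<Rightarrow> op set" for n :: nat where
  gen_id: "id_op n \<in> alg_gen n"
| gen_S: "i < n \<Longrightarrow> creation n i \<in> alg_gen n"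
| gen_add: "A \<in> alg_gen n \<Longrightarrow> B \<in> alg_gen n \<Longrightarrow> (\<lambda>\<psi> w. A \<psi> w + B \<psi> w) \<in> alg_gen n"
| gen_smult: "A \<in> alg_gen n \<Longrightarrow> (\<lambda>\<psi> w. c * A \<psi> w) \<in> alg_gen n"
| gen_comp: "A \<in> alg_gen n \<Longrightarrow> B \<in> alg_gen n \<Longrightarrow> A \<circ> B \<in> alg_gen n"

definition wot_closure :: "nat \<Rightarrow> op set \<Rightarrow> op set" where
  "wot_closure n \<A> = {T. bounded_op n T \<and>
     (\<forall>P \<epsilon>. finite P \<and> P \<subseteq> l2 n \<times> l2 n \<and> \<epsilon> > 0 \<longrightarrow>
        (\<exists>B\<in>\<A>. \<forall>(x, y)\<in>P. cmod (l2inner (T x) y - l2inner (B x) y) < \<epsilon>))}"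

definition Fn_inf :: "nat \<Rightarrow> op set" where
  "Fn_inf n = wot_closure n (alg_gen n)"

definition Fn_ball :: "nat \<Rightarrow> op set" where
  "Fn_ball n = {T \<in> Fn_inf n. opnorm n T \<le> 1}"

definition extreme_Fn :: "nat \<Rightarrow> op \<Rightarrow> bool" where
  "extreme_Fn n T \<longleftrightarrow> T \<in> Fn_ball n \<and>
     \<not> (\<exists>A\<in>Fn_ball n. \<exists>B\<in>Fn_ball n. \<exists>t::real. 0 < t \<and> t < 1 \<and> A \<noteq> B \<and>
           T = (\<lambda>\<psi> w. (1 - t) * A \<psi> w + t * B \<psi> w))"

text \<open>H^infinity of the disc; functions are normalised to be 0 off the open disc.\<close>
definition Hinf :: "(complex \<Rightarrow> complex) set" where
  "Hinf = {f. f holomorphic_on ball 0 1 \<and> bounded (f ` ball 0 1) \<and>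
              (\<forall>z. z \<notin> ball 0 1 \<longrightarrow> f z = 0)}"

definition Hinf_ball :: "(complex \<Rightarrow> complex) set" where
  "Hinf_ball = {f \<in> Hinf. \<forall>z\<in>ball 0 1. cmod (f z) \<le> 1}"

definition extreme_Hinf :: "(complex \<Rightarrow> complex) \<Rightarrow> bool" where
  "extreme_Hinf f \<longleftrightarrow> f \<in> Hinf_ball \<and>
     \<not> (\<exists>g\<in>Hinf_ball. \<exists>h\<in>Hinf_ball. \<exists>t::real. 0 < t \<and> t < 1 \<and> g \<noteq> h \<and>
           f = (\<lambda>z. (1 - t) * g z + t * h z))"

definition l2_tendsto :: "('a \<Rightarrow> vec) \<Rightarrow> vec \<Rightarrow> 'a filter \<Rightarrow> bool" where
  "l2_tendsto X L F \<longleftrightarrow> ((\<lambda>t. l2norm (\<lambda>w. X t w - L w)) \<longlongrightarrow> 0) F"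

definition l2_lim :: "nat \<Rightarrow> 'a filter \<Rightarrow> ('a \<Rightarrow> vec) \<Rightarrow> vec" where
  "l2_lim n F X = (THE L. L \<in> l2 n \<and> l2_tendsto X L F)"

definition taylor_coeff :: "(complex \<Rightarrow> complex) \<Rightarrow> nat \<Rightarrow> complex" where
  "taylor_coeff f k = (deriv ^^ k) f 0 / fact k"

text \<open>f(r S_1) = sum_k a_k r^k S_1^k (norm convergent for 0<=r<1), applied to psi.\<close>
definition fun_calc_r :: "nat \<Rightarrow> (complex \<Rightarrow> complex) \<Rightarrow> real \<Rightarrow> op" where
  "fun_calc_r n f r \<psi> = (if \<psi> \<in> l2 n then
      l2_lim n sequentially
        (\<lambda>N w. \<Sum>k<N. taylor_coeff f k * (complex_of_real r) ^ k * ((creation n 0 ^^ k) \<psi>) w)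
    else zero_vec)"

definition fun_calc :: "nat \<Rightarrow> (complex \<Rightarrow> complex) \<Rightarrow> op" where
  "fun_calc n f \<psi> = (if \<psi> \<in> l2 n then l2_lim n (at_left 1) (\<lambda>r. fun_calc_r n f r \<psi>)
                     else zero_vec)"

end

theory Submission
  imports Defs
begin

text \<open>
  If \<open>f(S\<^sub>1) = (1 - t) A + t B\<close> with contractions A and B, then
  \<open>\<parallel>f(S\<^sub>1) x\<parallel>\<^sup>2 + t(1 - t) \<parallel>(A - B) x\<parallel>\<^sup>2 \<le> \<parallel>x\<parallel>\<^sup>2\<close>. Elements of the algebra commute with the right creation
  operators, so \<open>A - B\<close> is determined by its value on the vacuum and acts on the vectors
  \<open>p(e\<^sub>1)\<close> as multiplication by a column of analytic functions. Testing on Szego kernels turns the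
  inequality into \<open>|f|\<^sup>2 + t(1 - t) |g|\<^sup>2 \<le> 1\<close> on the disc for every entry g of that column. If
  \<open>A \<noteq> B\<close>, some g is nonzero, and then f is the midpoint of \<open>f \<plusminus> t(1 - t) g\<^sup>2 / 2\<close>, both in the ball.
  Conversely \<open>f \<mapsto> f(S\<^sub>1)\<close> is linear, injective and isometric: von Neumann's inequality for the shift is
  obtained from Parseval's identity on roots of unity, and the opposite bound from the kernels.
\<close>

section \<open>Multiplication by a bounded analytic function\<close>

text \<open>The obstacle is that A and B need not be functions of S_1, so a splitting of f(S_1) is
  not by itself a splitting of f. What is kept of A - B is one scalar analytic function g, and the
  available inequality controls |g|^2 rather than |g|; hence the perturbation of f is quadratic in
  g. Words are cut in two ways. Left creation adds letters in front, so powers of S_1 are read off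
  from leading zeros. Right creation adds letters at the end, so an entry of the column belongs to a
  word v, empty or not ending in 0, and its Taylor coefficients sit at the words v 0^m. The two cuts
  meet on the words 0^m, where left and right creation by the first basis vector agree; the Szego
  kernels live there, and this links the functional calculus with the commutation property.\<close>

lemma discrete_parseval:
  fixes c :: "nat \<Rightarrow> complex"
  assumes "L > 0"
  shows "(\<Sum>j<L. (cmod (\<Sum>m<L. c m * cis (2 * pi * real j / real L) ^ m))\<^sup>2) = L * (\<Sum>m<L. (cmod (c m))\<^sup>2)"
proof -
  define q where "q = cis (2 * pi / L)"
  have w: "cis (2 * pi * real j / real L) = q ^ j" for j :: nat
    by (simp add: q_def Complex.DeMoivre field_simps)
  have qL: "q ^ L = 1" using assms by (simp add: q_def Complex.DeMoivre)
  have qc: "cnj q * q = 1" by (simp add: q_def cis_cnj cis_mult)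
  have q1: "q ^ d \<noteq> 1" if "0 < d" "d < L" for d
  proof
    assume "q ^ d = 1"
    then have "cis (2 * pi * d / L) = 1" by (simp add: w)
    then have "exp (\<i> * of_real (2 * pi * d / L)) = 1" by (simp only: cis_conv_exp)
    then obtain k :: int where "2 * pi * d / L = of_int (2 * k) * pi"
      by (auto simp: exp_eq_1)
    then have "real d = of_int k * L" using assms by (simp add: field_simps)
    then have "int d = k * int L" by (metis of_int_eq_iff of_int_mult of_int_of_nat_eq)
    then have "int L dvd int d" by simp
    then show False using that by (meson nat_dvd_not_less of_nat_dvd_iff)
  qed
  \<comment> \<open>Orthogonality of the characters of the cyclic group of order L: q^m cnj(q)^l is
    an L-th root of unity, equal to 1 only for m = l because q is primitive, so otherwise the
    geometric sum vanishes.\<close>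
  have orth: "(\<Sum>j<L. (q ^ j) ^ m * cnj ((q ^ j) ^ l)) = (if m = l then of_nat L else 0)"
    if "m < L" "l < L" for m l
  proof -
    have cn: "cnj q ^ k * q ^ k = 1" for k by (metis qc power_mult_distrib power_one)
    have *: "(\<Sum>j<L. (q ^ j) ^ m * cnj ((q ^ j) ^ l)) = (\<Sum>j<L. (q ^ m * cnj q ^ l) ^ j)"
      by (simp add: power_mult_distrib mult.commute flip: power_mult)
    let ?z = "q ^ m * cnj q ^ l"
    show ?thesis
    proof (cases "m = l")
      case True
      then have "?z = 1" using cn[of l] by (simp add: mult.commute)
      then show ?thesis unfolding * using True by simp
    next
      case False
      have zL: "?z ^ L = 1"
        by (metis (no_types, lifting) complex_cnj_one complex_cnj_power mult_1 power_commutes power_mult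
            power_mult_distrib power_one qL mult.commute)
      have "?z \<noteq> 1"
      proof
        assume a: "?z = 1"
        then have ml: "q ^ m = q ^ l" using cn[of l] by (metis mult.assoc mult.right_neutral mult_1)
        have q0: "q \<noteq> 0" by (simp add: q_def)
        show False
        proof (cases "m < l")
          case True
          then have "q ^ (l - m) = 1" using ml q0 by (simp add: power_diff)
          then show False using q1[of "l - m"] True that by auto
        next
          case F: False
          then have "q ^ (m - l) = 1" using ml q0 by (simp add: power_diff)
          then show False using q1[of "m - l"] F False that by auto
        qed
      qed
      then show ?thesis unfolding * using zL False by (simp add: sum_gp_strict)
    qed
  qed
  have "complex_of_real (\<Sum>j<L. (cmod (\<Sum>m<L. c m * (q ^ j) ^ m))\<^sup>2)
      = (\<Sum>j<L. (\<Sum>m<L. \<Sum>l<L. c m * cnj (c l) * ((q ^ j) ^ m * cnj ((q ^ j) ^ l))))"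
    by (simp only: of_real_sum complex_norm_square cnj_sum sum_product complex_cnj_mult mult_ac)
  also have "\<dots> = (\<Sum>m<L. \<Sum>l<L. \<Sum>j<L. c m * cnj (c l) * ((q ^ j) ^ m * cnj ((q ^ j) ^ l)))"
    by (subst sum.swap) (intro sum.cong refl sum.swap)
  also have "\<dots> = (\<Sum>m<L. \<Sum>l<L. c m * cnj (c l) * (if m = l then of_nat L else 0))"
    by (intro sum.cong refl) (simp add: orth flip: sum_distrib_left del: complex_cnj_power)
  also have "\<dots> = complex_of_real (L * (\<Sum>m<L. (cmod (c m))\<^sup>2))"
    by (simp add: complex_norm_square sum_distrib_left mult_ac if_distrib sum.delta
          del: of_real_power cong: if_cong)
  finally show ?thesis by (simp only: of_real_eq_iff w)
qed

text \<open>The mean over the L-th roots of unity, with L growing, takes the place of the integral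
  over the circle. Multiplication by the symbol costs at most a factor M at each root; cutting the
  product series at degree L costs at most the tail \<open>e L\<close> of an absolutely convergent
  series, which vanishes in the limit.\<close>

lemma toeplitz_bound_abs_summable:
  fixes b x :: "nat \<Rightarrow> complex"
  assumes sb: "summable (\<lambda>k. cmod (b k))"
    and bd: "\<And>z. cmod z = 1 \<Longrightarrow> cmod (\<Sum>k. b k * z ^ k) \<le> M"
  shows "(\<Sum>m<N. (cmod (\<Sum>k\<le>m. b k * x (m - k)))\<^sup>2) \<le> M\<^sup>2 * (\<Sum>m<N. (cmod (x m))\<^sup>2)"
proof -
  \<comment> \<open>Cutting x off at N makes it a polynomial. The first N output coefficients only
    see inputs before N, so they do not change.\<close>
  define y where "y m = (if m < N then x m else 0)" for m
  define c where "c m = (\<Sum>k\<le>m. b k * y (m - k))" for m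
  define P where "P = (\<Sum>m<N. cmod (x m))"
  have M0: "M \<ge> 0" using order_trans[OF norm_ge_zero bd[of 1]] by simp
  have sy: "summable (\<lambda>m. cmod (y m))"
    by (rule summable_finite[of "{..<N}"]) (auto simp: y_def)
  have nz: "cmod (a * z ^ k) = cmod a" if "cmod z = 1" for a z and k :: nat
    using that by (simp add: norm_mult norm_power)
  have cz: "(\<Sum>k\<le>m. (b k * z ^ k) * (y (m - k) * z ^ (m - k))) = c m * z ^ m" for m z
    unfolding c_def sum_distrib_right
    by (rule sum.cong) (auto simp: algebra_simps simp flip: power_add)
  have prod: "(\<lambda>m. c m * z ^ m) sums ((\<Sum>k. b k * z ^ k) * (\<Sum>k. y k * z ^ k))" if "cmod z = 1" for z
    using Cauchy_product_sums[of "\<lambda>k. b k * z ^ k" "\<lambda>k. y k * z ^ k"] sb sy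
    by (simp add: nz that cz)
  have sc: "summable (\<lambda>m. cmod (c m))"
  proof (rule summable_comparison_test'[where N=0])
    show "summable (\<lambda>m. \<Sum>k\<le>m. cmod (b k) * cmod (y (m - k)))"
      using summable_Cauchy_product[of "\<lambda>k. cmod (b k)" "\<lambda>k. cmod (y k)"] sb sy by simp
    show "norm (cmod (c m)) \<le> (\<Sum>k\<le>m. cmod (b k) * cmod (y (m - k)))" for m
      unfolding c_def by (simp add: sum_norm_le norm_mult)
  qed
  define e where "e L = (\<Sum>m. cmod (c m)) - (\<Sum>m<L. cmod (c m))" for L
  have e0: "e L \<ge> 0" for L unfolding e_def using sum_le_suminf[OF sc, of "{..<L}"] by simp
  have elim: "e \<longlonglongrightarrow> 0"
    unfolding e_def using tendsto_diff[OF tendsto_const[of "\<Sum>m. cmod (c m)"] summable_LIMSEQ[OF sc]] by simp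
  have py: "(\<Sum>k. y k * z ^ k) = (\<Sum>m<L. y m * z ^ m)" if "L \<ge> N" for L z
    by (rule suminf_finite) (use that in \<open>auto simp: y_def\<close>)
  have est: "(cmod (\<Sum>m<L. c m * z ^ m))\<^sup>2 \<le> M\<^sup>2 * (cmod (\<Sum>m<L. y m * z ^ m))\<^sup>2 + (2 * M * P * e L + (e L)\<^sup>2)"
    if z: "cmod z = 1" and L: "L \<ge> N" for z L
  proof -
    let ?p = "\<Sum>m<L. y m * z ^ m"
    \<comment> \<open>P bounds the polynomial independently of z and L, so the cross term in the
      square is a constant times \<open>e L\<close>.\<close>
    have pP: "cmod ?p \<le> P"
    proof -
      have "cmod ?p \<le> (\<Sum>m<L. cmod (y m))" by (rule sum_norm_le) (simp add: nz z)
      also have "\<dots> = P" unfolding P_def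
        by (rule sum.mono_neutral_cong_right) (use L in \<open>auto simp: y_def\<close>)
      finally show ?thesis .
    qed
    have s: "summable (\<lambda>m. c m * z ^ m)" using prod[OF z] by (rule sums_summable)
    have "cmod (\<Sum>m. c (m + L) * z ^ (m + L)) \<le> (\<Sum>m. cmod (c (m + L)))"
      using summable_norm[of "\<lambda>m. c (m + L) * z ^ (m + L)"] sc
      by (simp add: nz z summable_iff_shift[of "\<lambda>m. cmod (c m)"])
    also have "\<dots> = e L" unfolding e_def using suminf_minus_initial_segment[OF sc] by simp
    finally have t: "cmod (\<Sum>m. c (m + L) * z ^ (m + L)) \<le> e L" .
    have "(\<Sum>m<L. c m * z ^ m) = (\<Sum>m. c m * z ^ m) - (\<Sum>m. c (m + L) * z ^ (m + L))"
      using suminf_minus_initial_segment[OF s] by simp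
    then have "cmod (\<Sum>m<L. c m * z ^ m) \<le> cmod (\<Sum>m. c m * z ^ m) + e L"
      using t norm_triangle_ineq4[of "\<Sum>m. c m * z ^ m" "\<Sum>m. c (m + L) * z ^ (m + L)"] by simp
    also have "cmod (\<Sum>m. c m * z ^ m) = cmod (\<Sum>k. b k * z ^ k) * cmod ?p"
      using sums_unique[OF prod[OF z]] by (simp add: py[OF L] flip: norm_mult)
    also have "\<dots> \<le> M * cmod ?p" by (intro mult_right_mono bd z) auto
    finally have "(cmod (\<Sum>m<L. c m * z ^ m))\<^sup>2 \<le> (M * cmod ?p + e L)\<^sup>2" by (intro power_mono) auto
    also have "\<dots> = M\<^sup>2 * (cmod ?p)\<^sup>2 + (2 * M * cmod ?p * e L + (e L)\<^sup>2)"
      by (simp add: power2_eq_square algebra_simps)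
    also have "\<dots> \<le> M\<^sup>2 * (cmod ?p)\<^sup>2 + (2 * M * P * e L + (e L)\<^sup>2)"
      using M0 e0[of L] pP by (intro add_mono order_refl mult_right_mono mult_left_mono) auto
    finally show ?thesis .
  qed
  have fin: "(\<Sum>m<N. (cmod (c m))\<^sup>2) \<le> M\<^sup>2 * (\<Sum>m<N. (cmod (x m))\<^sup>2) + (2 * M * P * e L + (e L)\<^sup>2)"
    if L: "L \<ge> max N 1" for L
  proof -
    have Lp: "L > 0" and LN: "N \<le> L" using L by auto
    have "L * (\<Sum>m<L. (cmod (c m))\<^sup>2)
        \<le> (\<Sum>j<L. M\<^sup>2 * (cmod (\<Sum>m<L. y m * cis (2 * pi * real j / real L) ^ m))\<^sup>2 + (2 * M * P * e L + (e L)\<^sup>2))"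
      unfolding discrete_parseval[OF Lp, symmetric] by (intro sum_mono est LN) auto
    also have "\<dots> = M\<^sup>2 * (L * (\<Sum>m<L. (cmod (y m))\<^sup>2)) + L * (2 * M * P * e L + (e L)\<^sup>2)"
      unfolding sum.distrib sum_distrib_left[symmetric] discrete_parseval[OF Lp] by (simp add: algebra_simps)
    also have "\<dots> = L * (M\<^sup>2 * (\<Sum>m<L. (cmod (y m))\<^sup>2) + (2 * M * P * e L + (e L)\<^sup>2))"
      by (simp add: algebra_simps)
    also have "(\<Sum>m<L. (cmod (y m))\<^sup>2) = (\<Sum>m<N. (cmod (x m))\<^sup>2)"
      by (rule sum.mono_neutral_cong_right) (use LN in \<open>auto simp: y_def\<close>)
    finally have "(\<Sum>m<L. (cmod (c m))\<^sup>2) \<le> M\<^sup>2 * (\<Sum>m<N. (cmod (x m))\<^sup>2) + (2 * M * P * e L + (e L)\<^sup>2)"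
      using Lp by simp
    moreover have "(\<Sum>m<N. (cmod (c m))\<^sup>2) \<le> (\<Sum>m<L. (cmod (c m))\<^sup>2)"
      by (rule sum_mono2) (use LN in auto)
    ultimately show ?thesis by linarith
  qed
  have "(\<lambda>L. M\<^sup>2 * (\<Sum>m<N. (cmod (x m))\<^sup>2) + (2 * M * P * e L + (e L)\<^sup>2))
      \<longlonglongrightarrow> M\<^sup>2 * (\<Sum>m<N. (cmod (x m))\<^sup>2) + (2 * M * P * 0 + 0\<^sup>2)"
    by (intro tendsto_intros elim)
  then have "(\<Sum>m<N. (cmod (c m))\<^sup>2) \<le> M\<^sup>2 * (\<Sum>m<N. (cmod (x m))\<^sup>2)"
    using fin by (intro LIMSEQ_le_const[where X="\<lambda>L. M\<^sup>2 * (\<Sum>m<N. (cmod (x m))\<^sup>2) + (2 * M * P * e L + (e L)\<^sup>2)"]) (auto intro!: exI[of _ "max N 1"])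
  moreover have "c m = (\<Sum>k\<le>m. b k * x (m - k))" if "m < N" for m
    unfolding c_def y_def using that by (intro sum.cong) auto
  ultimately show ?thesis by simp
qed

text \<open>Passing to the coefficients b_k r^k gives absolute summability and keeps the bound M,
  because the dilated series takes values of the original one inside the disc. For fixed N the left
  side is a finite sum, continuous in r, so r may tend to 1.\<close>

lemma toeplitz_bound:
  fixes b x :: "nat \<Rightarrow> complex"
  assumes sb: "\<And>z. cmod z < 1 \<Longrightarrow> summable (\<lambda>k. b k * z ^ k)"
    and bd: "\<And>z. cmod z < 1 \<Longrightarrow> cmod (\<Sum>k. b k * z ^ k) \<le> M"
  shows "(\<Sum>m<N. (cmod (\<Sum>k\<le>m. b k * x (m - k)))\<^sup>2) \<le> M\<^sup>2 * (\<Sum>m<N. (cmod (x m))\<^sup>2)"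
proof -
  have r: "(\<Sum>m<N. (cmod (\<Sum>k\<le>m. b k * complex_of_real r ^ k * x (m - k)))\<^sup>2) \<le> M\<^sup>2 * (\<Sum>m<N. (cmod (x m))\<^sup>2)"
    if "0 < r" "r < 1" for r :: real
  proof (rule toeplitz_bound_abs_summable)
    have "summable (\<lambda>k. norm (b k * complex_of_real r ^ k))"
      \<comment> \<open>The point (1 + r) / 2 lies strictly between r and 1; convergence there gives
        absolute convergence at r.\<close>
      by (rule powser_insidea[where x="complex_of_real ((1 + r) / 2)"]) (use that in \<open>auto intro!: sb simp del: of_real_divide of_real_add\<close>)
    then show "summable (\<lambda>k. cmod (b k * complex_of_real r ^ k))" by simp
    show "cmod (\<Sum>k. b k * complex_of_real r ^ k * z ^ k) \<le> M" if "cmod z = 1" for z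
      using bd[of "of_real r * z"] that \<open>0 < r\<close> \<open>r < 1\<close> by (simp add: norm_mult power_mult_distrib mult.assoc)
  qed
  have "((\<lambda>r. \<Sum>m<N. (cmod (\<Sum>k\<le>m. b k * complex_of_real r ^ k * x (m - k)))\<^sup>2)
      \<longlongrightarrow> (\<Sum>m<N. (cmod (\<Sum>k\<le>m. b k * complex_of_real 1 ^ k * x (m - k)))\<^sup>2)) (at_left 1)"
    by (intro tendsto_intros)
  moreover have "\<forall>\<^sub>F r in at_left (1::real). (\<Sum>m<N. (cmod (\<Sum>k\<le>m. b k * complex_of_real r ^ k * x (m - k)))\<^sup>2) \<le> M\<^sup>2 * (\<Sum>m<N. (cmod (x m))\<^sup>2)"
    by (rule eventually_at_leftI[of 0]) (auto intro: r)
  ultimately have "(\<Sum>m<N. (cmod (\<Sum>k\<le>m. b k * complex_of_real 1 ^ k * x (m - k)))\<^sup>2) \<le> M\<^sup>2 * (\<Sum>m<N. (cmod (x m))\<^sup>2)"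
    by (rule tendsto_upperbound) simp
  then show ?thesis by simp
qed

section \<open>The Fock space\<close>

lemma l2norm_nonneg: "l2norm \<psi> \<ge> 0"
  unfolding l2norm_def by (intro real_sqrt_ge_zero infsum_nonneg) auto

lemma l2norm_power2: "(l2norm \<psi>)\<^sup>2 = (\<Sum>\<^sub>\<infinity>w. (cmod (\<psi> w))\<^sup>2)"
  unfolding l2norm_def by (intro real_sqrt_pow2 infsum_nonneg) auto

lemma l2_sum_le:
  assumes "\<psi> \<in> l2 n" "finite F"
  shows "(\<Sum>w\<in>F. (cmod (\<psi> w))\<^sup>2) \<le> (l2norm \<psi>)\<^sup>2"
  unfolding l2norm_power2 using assms by (intro finite_sum_le_infsum) (auto simp: l2_def)

lemma l2_component_le:
  assumes "\<psi> \<in> l2 n"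
  shows "cmod (\<psi> w) \<le> l2norm \<psi>"
  using l2_sum_le[OF assms, of "{w}"] by (simp add: power2_le_iff_abs_le l2norm_nonneg)

lemma l2_boundedI:
  assumes "\<And>w. w \<notin> words n \<Longrightarrow> \<psi> w = 0" and "0 \<le> C"
    and "\<And>F. finite F \<Longrightarrow> (\<Sum>w\<in>F. (cmod (\<psi> w))\<^sup>2) \<le> C\<^sup>2"
  shows "\<psi> \<in> l2 n" "l2norm \<psi> \<le> C"
proof -
  have s: "(\<lambda>w. (cmod (\<psi> w))\<^sup>2) summable_on UNIV"
    by (rule nonneg_bdd_above_summable_on) (auto intro!: bdd_aboveI[of _ "C\<^sup>2"] assms(3))
  then show "\<psi> \<in> l2 n" using assms(1) by (simp add: l2_def)
  have "(l2norm \<psi>)\<^sup>2 \<le> C\<^sup>2"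
    unfolding l2norm_power2 by (rule infsum_le_finite_sums[OF s]) (use assms(3) in auto)
  then show "l2norm \<psi> \<le> C" using assms(2) by (rule power2_le_imp_le)
qed

lemma l2_vanishes: "\<psi> \<in> l2 n \<Longrightarrow> w \<notin> words n \<Longrightarrow> \<psi> w = 0"
  by (simp add: l2_def)

lemma l2_zero: "(\<lambda>w. 0) \<in> l2 n" "l2norm (\<lambda>w. 0) = 0"
  by (auto simp: l2_def l2norm_def)

lemma l2_smult:
  assumes "\<psi> \<in> l2 n"
  shows "(\<lambda>w. a * \<psi> w) \<in> l2 n"
  using assms by (auto simp: l2_def norm_mult power_mult_distrib intro: summable_on_cmult_right)

lemma l2norm_smult: "l2norm (\<lambda>w. a * \<psi> w) = cmod a * l2norm \<psi>"
  by (simp add: l2norm_def norm_mult power_mult_distrib infsum_cmult_right' real_sqrt_mult)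

lemma cmod_add_power2_le: "(cmod (x + y))\<^sup>2 \<le> 2 * (cmod x)\<^sup>2 + 2 * (cmod y)\<^sup>2"
proof -
  have "(cmod (x + y))\<^sup>2 \<le> (cmod x + cmod y)\<^sup>2" by (intro power_mono norm_triangle_ineq) auto
  also have "\<dots> \<le> 2 * (cmod x)\<^sup>2 + 2 * (cmod y)\<^sup>2"
    using sum_squares_bound[of "cmod x" "cmod y"] by (simp add: power2_sum)
  finally show ?thesis .
qed

text \<open>The termwise bound |x + y|^2 <= 2|x|^2 + 2|y|^2 is weaker than the triangle inequality,
  but enough for closure under addition and for sums of two norms that tend to 0.\<close>

lemma l2_add_aux:
  assumes "\<psi> \<in> l2 n" "\<phi> \<in> l2 n"
  shows l2_add: "(\<lambda>w. \<psi> w + \<phi> w) \<in> l2 n"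
    and l2norm_add_le: "l2norm (\<lambda>w. \<psi> w + \<phi> w) \<le> sqrt (2 * (l2norm \<psi>)\<^sup>2 + 2 * (l2norm \<phi>)\<^sup>2)"
proof -
  have *: "(\<Sum>w\<in>F. (cmod (\<psi> w + \<phi> w))\<^sup>2) \<le> (sqrt (2 * (l2norm \<psi>)\<^sup>2 + 2 * (l2norm \<phi>)\<^sup>2))\<^sup>2" if "finite F" for F
  proof -
    have "(\<Sum>w\<in>F. (cmod (\<psi> w + \<phi> w))\<^sup>2) \<le> (\<Sum>w\<in>F. 2 * (cmod (\<psi> w))\<^sup>2 + 2 * (cmod (\<phi> w))\<^sup>2)"
      by (intro sum_mono cmod_add_power2_le)
    also have "\<dots> \<le> 2 * (l2norm \<psi>)\<^sup>2 + 2 * (l2norm \<phi>)\<^sup>2"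
      using l2_sum_le[OF assms(1) that] l2_sum_le[OF assms(2) that]
      by (simp add: sum.distrib flip: sum_distrib_left)
    finally show ?thesis by simp
  qed
  show "(\<lambda>w. \<psi> w + \<phi> w) \<in> l2 n" "l2norm (\<lambda>w. \<psi> w + \<phi> w) \<le> sqrt (2 * (l2norm \<psi>)\<^sup>2 + 2 * (l2norm \<phi>)\<^sup>2)"
    by (rule l2_boundedI[where n=n, OF _ _ *]; use assms in \<open>auto simp: l2_vanishes\<close>)+
qed

lemma l2_diff:
  assumes "\<psi> \<in> l2 n" "\<phi> \<in> l2 n"
  shows "(\<lambda>w. \<psi> w - \<phi> w) \<in> l2 n"
  using l2_add[OF assms(1) l2_smult[OF assms(2), of "-1"]] by simp

abbreviation delta :: "nat list \<Rightarrow> vec" where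
  "delta u \<equiv> (\<lambda>w. if w = u then 1 else 0)"

lemma l2_delta:
  assumes "u \<in> words n"
  shows "delta u \<in> l2 n"
proof (rule l2_boundedI(1)[where C=1])
  fix F :: "nat list set" assume "finite F"
  moreover have "(cmod (if w = u then 1 else 0))\<^sup>2 = (if w = u then 1 else 0)" for w by simp
  ultimately show "(\<Sum>w\<in>F. (cmod (if w = u then 1 else 0))\<^sup>2) \<le> 1\<^sup>2"
    by (simp only: sum.delta) simp
qed (use assms in auto)

lemma l2inner_delta: "l2inner \<psi> (delta u) = \<psi> u"
proof -
  have "l2inner \<psi> (delta u) = (\<Sum>\<^sub>\<infinity>w\<in>{u}. \<psi> w)"
    unfolding l2inner_def by (rule infsum_cong_neutral) auto
  then show ?thesis by simp
qed

lemma l2_cauchy_schwarz: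
  assumes "\<psi> \<in> l2 n" "\<phi> \<in> l2 n"
  shows l2inner_summable: "(\<lambda>w. \<psi> w * cnj (\<phi> w)) summable_on UNIV"
    and cmod_l2inner_le: "cmod (l2inner \<psi> \<phi>) \<le> l2norm \<psi> * l2norm \<phi>"
proof -
  have *: "(\<Sum>w\<in>F. cmod (\<psi> w * cnj (\<phi> w))) \<le> l2norm \<psi> * l2norm \<phi>" if "finite F" for F
  proof -
    have "(\<Sum>w\<in>F. cmod (\<psi> w * cnj (\<phi> w))) \<le> L2_set (\<lambda>w. cmod (\<psi> w)) F * L2_set (\<lambda>w. cmod (\<phi> w)) F"
      using L2_set_mult_ineq[of "\<lambda>w. cmod (\<psi> w)" "\<lambda>w. cmod (\<phi> w)" F] by (simp add: norm_mult)
    also have "\<dots> \<le> l2norm \<psi> * l2norm \<phi>"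
      unfolding L2_set_def
      by (intro mult_mono real_le_lsqrt l2_sum_le[OF assms(1) that] l2_sum_le[OF assms(2) that] l2norm_nonneg real_sqrt_ge_zero sum_nonneg) auto
    finally show ?thesis .
  qed
  have s: "(\<lambda>w. cmod (\<psi> w * cnj (\<phi> w))) summable_on UNIV"
    by (rule nonneg_bdd_above_summable_on) (auto intro!: bdd_aboveI[of _ "l2norm \<psi> * l2norm \<phi>"] *)
  then show "(\<lambda>w. \<psi> w * cnj (\<phi> w)) summable_on UNIV" by (rule abs_summable_summable)
  have "cmod (l2inner \<psi> \<phi>) \<le> (\<Sum>\<^sub>\<infinity>w. cmod (\<psi> w * cnj (\<phi> w)))"
    unfolding l2inner_def by (rule norm_infsum_bound[OF s])
  also have "\<dots> \<le> l2norm \<psi> * l2norm \<phi>" by (rule infsum_le_finite_sums[OF s]) (use * in auto)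
  finally show "cmod (l2inner \<psi> \<phi>) \<le> l2norm \<psi> * l2norm \<phi>" .
qed

lemma l2inner_diff:
  assumes "\<psi> \<in> l2 n" "\<psi>' \<in> l2 n" "\<phi> \<in> l2 n"
  shows "l2inner \<psi> \<phi> - l2inner \<psi>' \<phi> = l2inner (\<lambda>w. \<psi> w - \<psi>' w) \<phi>"
proof -
  have "l2inner \<psi> \<phi> = (\<Sum>\<^sub>\<infinity>w. (\<psi> w - \<psi>' w) * cnj (\<phi> w) + \<psi>' w * cnj (\<phi> w))"
    unfolding l2inner_def by (simp add: algebra_simps)
  also have "\<dots> = l2inner (\<lambda>w. \<psi> w - \<psi>' w) \<phi> + l2inner \<psi>' \<phi>"
    unfolding l2inner_def
    using l2inner_summable[OF l2_diff[OF assms(1,2)] assms(3)] l2inner_summable[OF assms(2,3)]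
    by (rule infsum_add)
  finally show ?thesis by simp
qed

section \<open>Limits in the Fock space\<close>

lemma l2_lim_eqI:
  assumes F: "F \<noteq> bot" and L: "L \<in> l2 n" "l2_tendsto X L F" and X: "\<forall>\<^sub>F t in F. X t \<in> l2 n"
  shows "l2_lim n F X = L"
  unfolding l2_lim_def
proof (rule the_equality)
  \<comment> \<open>Norm convergence forces coordinatewise convergence, and coordinate limits along
    a proper filter are unique; this identifies the definite description with L.\<close>
  have pt: "((\<lambda>t. X t w) \<longlongrightarrow> L' w) F" if "L' \<in> l2 n" "l2_tendsto X L' F" for L' w
  proof (rule Lim_transform_bound[where g="\<lambda>t. l2norm (\<lambda>w. X t w - L' w)", THEN LIM_zero_cancel])
    show "((\<lambda>t. l2norm (\<lambda>w. X t w - L' w)) \<longlongrightarrow> 0) F" using that by (simp add: l2_tendsto_def)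
    show "\<forall>\<^sub>F t in F. norm (X t w - L' w) \<le> norm (l2norm (\<lambda>w. X t w - L' w))"
      using X by eventually_elim (use l2_component_le[OF l2_diff] that in \<open>force simp: l2norm_nonneg\<close>)
  qed
  show "L \<in> l2 n \<and> l2_tendsto X L F" using L by simp
  fix L' assume "L' \<in> l2 n \<and> l2_tendsto X L' F"
  then have "L' w = L w" for w using pt L tendsto_unique[OF F] by blast
  then show "L' = L" by auto
qed

text \<open>Dominated convergence for the counting measure: a finite set G carries all but e^2/4 of
  the squared norm of \<xi>, and only finitely many coordinates have to tend to 0 on G. The filter
  is arbitrary, so this serves both for r -> 1 and for the net of finite sets of words.\<close>

lemma l2norm_multiplier_tendsto_0:
  assumes \<xi>: "\<xi> \<in> l2 n" and le: "\<forall>\<^sub>F t in F. \<forall>w. cmod (c t w) \<le> 1"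
    and lim: "\<And>w. ((\<lambda>t. c t w) \<longlongrightarrow> 0) F"
  shows "((\<lambda>t. l2norm (\<lambda>w. c t w * \<xi> w)) \<longlongrightarrow> 0) F"
proof (rule tendstoI)
  fix e :: real assume e: "e > 0"
  let ?f = "\<lambda>w. (cmod (\<xi> w))\<^sup>2"
  have s: "?f summable_on UNIV" using \<xi> by (simp add: l2_def)
  have "\<forall>\<^sub>F G in finite_subsets_at_top UNIV. dist (sum ?f G) (infsum ?f UNIV) < e\<^sup>2 / 4"
    using tendstoD[OF infsum_tendsto[OF s], of "e\<^sup>2 / 4"] e by simp
  then obtain G where G: "finite G" and "dist (sum ?f G) (infsum ?f UNIV) < e\<^sup>2 / 4"
    by (auto simp: eventually_finite_subsets_at_top)
  then have tail: "infsum ?f UNIV - sum ?f G < e\<^sup>2 / 4" by (simp add: dist_real_def abs_if split: if_splits)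
  have "((\<lambda>t. \<Sum>w\<in>G. (cmod (c t w * \<xi> w))\<^sup>2) \<longlongrightarrow> (\<Sum>w\<in>G. (cmod (0 * \<xi> w))\<^sup>2)) F"
    by (intro tendsto_intros lim)
  then have "\<forall>\<^sub>F t in F. (\<Sum>w\<in>G. (cmod (c t w * \<xi> w))\<^sup>2) < e\<^sup>2 / 4"
    using e order_tendstoD(2)[of _ 0 F "e\<^sup>2 / 4"] by simp
  with le show "\<forall>\<^sub>F t in F. dist (l2norm (\<lambda>w. c t w * \<xi> w)) 0 < e"
  proof eventually_elim
    case (elim t)
    have le1: "(cmod (c t w * \<xi> w))\<^sup>2 \<le> ?f w" for w
      using elim(1) by (intro power_mono) (auto simp: norm_mult intro!: mult_left_le_one_le)
    have "l2norm (\<lambda>w. c t w * \<xi> w) \<le> sqrt (e\<^sup>2 / 2)"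
    proof (rule l2_boundedI(2)[where n=n])
      fix H :: "nat list set" assume H: "finite H"
      have "(\<Sum>w\<in>H. (cmod (c t w * \<xi> w))\<^sup>2) \<le> (\<Sum>w\<in>G \<union> (H - G). (cmod (c t w * \<xi> w))\<^sup>2)"
        by (rule sum_mono2) (use G H in auto)
      also have "\<dots> = (\<Sum>w\<in>G. (cmod (c t w * \<xi> w))\<^sup>2) + (\<Sum>w\<in>H - G. (cmod (c t w * \<xi> w))\<^sup>2)"
        by (rule sum.union_disjoint) (use G H in auto)
      also have "(\<Sum>w\<in>H - G. (cmod (c t w * \<xi> w))\<^sup>2) \<le> sum ?f (H - G)" by (intro sum_mono le1)
      also have "sum ?f (H - G) = sum ?f (G \<union> (H - G)) - sum ?f G"
        by (subst sum.union_disjoint) (use G H in auto)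
      also have "sum ?f (G \<union> (H - G)) \<le> infsum ?f UNIV"
        by (rule finite_sum_le_infsum[OF s]) (use G H in auto)
      finally show "(\<Sum>w\<in>H. (cmod (c t w * \<xi> w))\<^sup>2) \<le> (sqrt (e\<^sup>2 / 2))\<^sup>2"
        using elim(2) tail by simp
    qed (use \<xi> in \<open>auto simp: l2_vanishes\<close>)
    also have "\<dots> < sqrt (e\<^sup>2)" using e by (intro real_sqrt_less_mono) auto
    finally show ?case using e by (simp add: l2norm_nonneg)
  qed
qed

section \<open>Power series in the first creation operator\<close>

text \<open>Height of a word in its chain v, 0v, 00v, ... with v empty or starting with a nonzero
  letter. Every word lies on exactly one chain, and S_1 acts along each chain as the unilateral
  shift.\<close>

definition lead0 :: "nat list \<Rightarrow> nat" where
  "lead0 w = length (takeWhile ((=) 0) w)"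

text \<open>\<open>conv b\<close> is the formal series \<open>\<Sum>\<^sub>k b\<^sub>k S\<^sub>1\<^sup>k\<close> evaluated coordinatewise, where only finitely many terms
  contribute.\<close>

definition conv :: "(nat \<Rightarrow> complex) \<Rightarrow> vec \<Rightarrow> vec" where
  "conv b \<psi> w = (\<Sum>k\<le>lead0 w. b k * \<psi> (drop k w))"

lemma lead0_append: "v = [] \<or> hd v \<noteq> 0 \<Longrightarrow> lead0 (replicate m 0 @ v) = m"
  by (cases v) (auto simp: lead0_def takeWhile_append)

lemma replicate_lead0: "replicate (lead0 w) 0 @ dropWhile ((=) 0) w = w"
proof -
  have "replicate (lead0 w) 0 = takeWhile ((=) 0) w"
    unfolding lead0_def by (rule replicate_length_same) (auto dest: set_takeWhileD)
  then show ?thesis by simp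
qed

lemma dropWhile_hd_nonzero: "dropWhile ((=) (0::nat)) w = [] \<or> hd (dropWhile ((=) 0) w) \<noteq> 0"
  using hd_dropWhile[of "(=) 0" w] by metis

lemma drop_le_lead0: "k \<le> lead0 w \<Longrightarrow> drop k w = replicate (lead0 w - k) 0 @ dropWhile ((=) 0) w"
  using arg_cong[OF replicate_lead0[of w], of "drop k"] by simp

lemma lead0_drop: "k \<le> lead0 w \<Longrightarrow> lead0 (drop k w) = lead0 w - k"
  using lead0_append[OF dropWhile_hd_nonzero] by (simp add: drop_le_lead0)

lemma drop_lead0_notin_words:
  assumes "1 \<le> n" "k \<le> lead0 w" "w \<notin> words n"
  shows "drop k w \<notin> words n"
proof -
  obtain i where i: "i \<in> set w" "\<not> i < n" using assms(3) by (auto simp: words_def)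
  have "set w \<subseteq> insert 0 (set (dropWhile ((=) 0) w))"
    using arg_cong[OF replicate_lead0[of w], of set] by auto
  then have "i \<in> set (drop k w)" using i assms(1) by (auto simp: drop_le_lead0[OF assms(2)])
  then show ?thesis using i by (auto simp: words_def)
qed

text \<open>Along a chain 0^m v with v fixed, \<open>conv b\<close> is the lower triangular Toeplitz
  matrix of b, and different chains do not interact. A finite set F is enlarged to finitely many
  chains cut at a common height N, and the scalar bound is summed over them.\<close>

lemma conv_bound:
  assumes n: "1 \<le> n" and \<psi>: "\<psi> \<in> l2 n"
    and sb: "\<And>z. cmod z < 1 \<Longrightarrow> summable (\<lambda>k. b k * z ^ k)"
    and bd: "\<And>z. cmod z < 1 \<Longrightarrow> cmod (\<Sum>k. b k * z ^ k) \<le> M"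
  shows conv_in_l2: "conv b \<psi> \<in> l2 n" and l2norm_conv_le: "l2norm (conv b \<psi>) \<le> M * l2norm \<psi>"
proof -
  have M0: "M \<ge> 0" by (rule order_trans[OF norm_ge_zero bd[of 0]]) simp
  have *: "(\<Sum>w\<in>F. (cmod (conv b \<psi> w))\<^sup>2) \<le> (M * l2norm \<psi>)\<^sup>2" if F: "finite F" for F
  proof -
    define N where "N = Suc (Max (insert 0 (lead0 ` F)))"
    define V where "V = (\<lambda>w. dropWhile ((=) 0) w) ` F"
    let ?j = "\<lambda>(v, m). replicate m (0::nat) @ v"
    have V: "v = [] \<or> hd v \<noteq> 0" if "v \<in> V" for v
      using that dropWhile_hd_nonzero unfolding V_def by blast
    have fV: "finite V" using F by (simp add: V_def)
    have inj: "inj_on ?j (V \<times> {..<N})"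
    proof (rule inj_onI; clarify)
      fix v m v' m' assume "v \<in> V" "v' \<in> V" and e: "replicate m (0::nat) @ v = replicate m' 0 @ v'"
      then have "m = m'"
        using lead0_append[OF V[of v], of m] lead0_append[OF V[of v'], of m'] by simp
      then show "v = v' \<and> m = m'" using e by simp
    qed
    have sub: "F \<subseteq> ?j ` (V \<times> {..<N})"
    proof
      fix w assume w: "w \<in> F"
      have "w = ?j (dropWhile ((=) 0) w, lead0 w)" by (simp add: replicate_lead0)
      moreover have "lead0 w < N" unfolding N_def using F w by (simp add: less_Suc_eq_le)
      ultimately show "w \<in> ?j ` (V \<times> {..<N})" using w unfolding V_def by blast
    qed
    have cv: "conv b \<psi> (replicate m 0 @ v) = (\<Sum>k\<le>m. b k * \<psi> (replicate (m - k) 0 @ v))" if "v \<in> V" for v m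
      unfolding conv_def lead0_append[OF V[OF that]] by (intro sum.cong) auto
    have "(\<Sum>w\<in>F. (cmod (conv b \<psi> w))\<^sup>2) \<le> (\<Sum>w\<in>?j ` (V \<times> {..<N}). (cmod (conv b \<psi> w))\<^sup>2)"
      by (rule sum_mono2) (use sub fV in auto)
    also have "\<dots> = (\<Sum>v\<in>V. \<Sum>m<N. (cmod (conv b \<psi> (replicate m 0 @ v)))\<^sup>2)"
      by (subst sum.reindex[OF inj]) (simp add: sum.cartesian_product case_prod_beta)
    also have "\<dots> \<le> (\<Sum>v\<in>V. M\<^sup>2 * (\<Sum>m<N. (cmod (\<psi> (replicate m 0 @ v)))\<^sup>2))"
    proof (rule sum_mono)
      fix v assume "v \<in> V"
      then show "(\<Sum>m<N. (cmod (conv b \<psi> (replicate m 0 @ v)))\<^sup>2) \<le> M\<^sup>2 * (\<Sum>m<N. (cmod (\<psi> (replicate m 0 @ v)))\<^sup>2)"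
        using toeplitz_bound[OF sb bd, of "\<lambda>m. \<psi> (replicate m 0 @ v)" N] by (simp add: cv)
    qed
    also have "\<dots> = M\<^sup>2 * (\<Sum>w\<in>?j ` (V \<times> {..<N}). (cmod (\<psi> w))\<^sup>2)"
      by (subst sum.reindex[OF inj]) (simp add: sum.cartesian_product case_prod_beta flip: sum_distrib_left)
    also have "\<dots> \<le> M\<^sup>2 * (l2norm \<psi>)\<^sup>2" using fV by (intro mult_left_mono l2_sum_le[OF \<psi>]) auto
    finally show ?thesis by (simp add: power_mult_distrib)
  qed
  have van: "conv b \<psi> w = 0" if "w \<notin> words n" for w
    unfolding conv_def using drop_lead0_notin_words[OF n _ that] l2_vanishes[OF \<psi>] by simp
  show "conv b \<psi> \<in> l2 n" "l2norm (conv b \<psi>) \<le> M * l2norm \<psi>"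
    by (rule l2_boundedI[where n=n, OF van mult_nonneg_nonneg[OF M0 l2norm_nonneg] *]; assumption)+
qed

lemma conv_bound_abs_summable:
  assumes n: "1 \<le> n" and \<psi>: "\<psi> \<in> l2 n" and sb: "summable (\<lambda>k. cmod (b k))"
  shows conv_abs_in_l2: "conv b \<psi> \<in> l2 n"
    and l2norm_conv_abs_le: "l2norm (conv b \<psi>) \<le> (\<Sum>k. cmod (b k)) * l2norm \<psi>"
proof -
  have le: "cmod (b k * z ^ k) \<le> cmod (b k)" if "cmod z < 1" for z k
    using that by (simp add: norm_mult norm_power mult_left_le power_le_one)
  have s: "summable (\<lambda>k. cmod (b k * z ^ k))" if "cmod z < 1" for z
    by (rule summable_comparison_test'[OF sb, where N=0]) (use le[OF that] in auto)
  have 1: "summable (\<lambda>k. b k * z ^ k)" if "cmod z < 1" for z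
    using s[OF that] by (rule summable_norm_cancel)
  have 2: "cmod (\<Sum>k. b k * z ^ k) \<le> (\<Sum>k. cmod (b k))" if "cmod z < 1" for z
    using summable_norm[OF s[OF that]] suminf_le[OF le[OF that] s[OF that] sb] by linarith
  show "conv b \<psi> \<in> l2 n" "l2norm (conv b \<psi>) \<le> (\<Sum>k. cmod (b k)) * l2norm \<psi>"
    using conv_bound[OF n \<psi> 1 2] by auto
qed

lemma conv_diff: "conv b \<psi> w - conv c \<psi> w = conv (\<lambda>k. b k - c k) \<psi> w"
  by (simp add: conv_def left_diff_distrib sum_subtractf)

text \<open>Covers left and right creation at once: adding a letter at either end is an injection of
  words, and \<phi> is \<psi> carried along it.\<close>

lemma l2_pushforward:
  assumes \<psi>: "\<psi> \<in> l2 n" and g: "inj g" "\<And>w. w \<in> words n \<Longrightarrow> g w \<in> words n"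
    and \<phi>: "\<And>w. \<phi> (g w) = \<psi> w" "\<And>w. w \<notin> range g \<Longrightarrow> \<phi> w = 0"
  shows "\<phi> \<in> l2 n"
proof (rule l2_boundedI(1)[OF _ l2norm_nonneg])
  show "\<phi> w = 0" if "w \<notin> words n" for w
    using that g(2) \<phi> l2_vanishes[OF \<psi>] by (metis rangeE)
  fix F :: "nat list set" assume F: "finite F"
  have "(\<Sum>w\<in>F. (cmod (\<phi> w))\<^sup>2) = (\<Sum>w\<in>g ` (g -` F). (cmod (\<phi> w))\<^sup>2)"
    by (rule sum.mono_neutral_right) (use F \<phi>(2) in \<open>auto simp: image_vimage_eq\<close>)
  also have "\<dots> = (\<Sum>w\<in>g -` F. (cmod (\<psi> w))\<^sup>2)"
    by (subst sum.reindex) (use g(1) \<phi>(1) in \<open>auto intro: inj_on_subset\<close>)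
  also have "\<dots> \<le> (l2norm \<psi>)\<^sup>2" by (intro l2_sum_le[OF \<psi>] finite_vimageI F g(1))
  finally show "(\<Sum>w\<in>F. (cmod (\<phi> w))\<^sup>2) \<le> (l2norm \<psi>)\<^sup>2" .
qed

lemma creation_in_l2:
  assumes "i < n" "\<psi> \<in> l2 n"
  shows "creation n i \<psi> \<in> l2 n"
  by (rule l2_pushforward[OF assms(2), of "(#) i"])
     (use assms in \<open>auto simp: creation_def words_def split: list.splits\<close>)

lemma creation0_funpow:
  assumes "1 \<le> n" "\<psi> \<in> l2 n"
  shows "(creation n 0 ^^ k) \<psi> \<in> l2 n"
    and "(creation n 0 ^^ k) \<psi> w = (if k \<le> lead0 w then \<psi> (drop k w) else 0)"
proof -
  show l: "(creation n 0 ^^ k) \<psi> \<in> l2 n" for k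
    by (induction k) (use assms in \<open>auto intro: creation_in_l2\<close>)
  show "(creation n 0 ^^ k) \<psi> w = (if k \<le> lead0 w then \<psi> (drop k w) else 0)"
  proof (induction k arbitrary: w)
    case (Suc k)
    have "(creation n 0 ^^ Suc k) \<psi> w = creation n 0 ((creation n 0 ^^ k) \<psi>) w" by simp
    also have "\<dots> = (case w of [] \<Rightarrow> 0 | j # v \<Rightarrow> if j = 0 then (creation n 0 ^^ k) \<psi> v else 0)"
      unfolding creation_def[of n 0 "(creation n 0 ^^ k) \<psi>"] using l[of k] by simp
    also have "\<dots> = (if Suc k \<le> lead0 w then \<psi> (drop (Suc k) w) else 0)"
      using Suc.IH by (cases w) (auto simp: lead0_def)
    finally show ?case .
  qed auto
qed

text \<open>A partial sum is again a \<open>conv\<close>, with coefficients cut off at N. Its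
  difference from the full series is then, up to sign, the \<open>conv\<close> of the tail, to which
  the norm bound applies.\<close>

lemma sum_creation0_funpow:
  assumes "1 \<le> n" "\<psi> \<in> l2 n"
  shows "(\<Sum>k<N. b k * (creation n 0 ^^ k) \<psi> w) = conv (\<lambda>k. if k < N then b k else 0) \<psi> w"
  unfolding conv_def creation0_funpow(2)[OF assms]
  by (simp add: if_distrib if_distribR sum.If_cases cong: if_cong)
     (rule sum.cong, auto)

lemma partial_sums_l2_tendsto:
  assumes n: "1 \<le> n" and \<psi>: "\<psi> \<in> l2 n" and sb: "summable (\<lambda>k. cmod (b k))"
  shows "l2_tendsto (\<lambda>N w. \<Sum>k<N. b k * (creation n 0 ^^ k) \<psi> w) (conv b \<psi>) sequentially"
  unfolding l2_tendsto_def sum_creation0_funpow[OF n \<psi>] conv_diff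
proof (rule tendsto_sandwich[OF always_eventually always_eventually tendsto_const])
  define e where "e N = (\<Sum>k. cmod (b k)) - (\<Sum>k<N. cmod (b k))" for N
  let ?d = "\<lambda>N k. (if k < N then b k else 0) - b k"
  have sd: "summable (\<lambda>k. cmod (?d N k))" for N
    by (rule summable_comparison_test'[OF sb, where N=0]) auto
  have "(\<Sum>k. cmod (?d N k)) = e N" for N
  proof -
    have "(\<Sum>k. cmod (?d N k)) = (\<Sum>k. cmod (b k) - (if k < N then cmod (b k) else 0))"
      by (rule suminf_cong) auto
    also have "\<dots> = (\<Sum>k. cmod (b k)) - (\<Sum>k. if k < N then cmod (b k) else 0)"
      by (rule suminf_diff[symmetric, OF sb]) (rule summable_finite[of "{..<N}"], auto)
    also have "(\<Sum>k. if k < N then cmod (b k) else 0) = (\<Sum>k<N. cmod (b k))"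
      by (subst suminf_finite[of "{..<N}"]) auto
    finally show ?thesis by (simp add: e_def)
  qed
  then show "\<forall>N. l2norm (conv (?d N) \<psi>) \<le> e N * l2norm \<psi>"
    using l2norm_conv_abs_le[OF n \<psi> sd] by simp
  have "e \<longlonglongrightarrow> 0"
    unfolding e_def using tendsto_diff[OF tendsto_const[of "\<Sum>m. cmod (b m)"] summable_LIMSEQ[OF sb]] by simp
  then show "(\<lambda>N. e N * l2norm \<psi>) \<longlonglongrightarrow> 0" by (rule tendsto_mult_left_zero)
qed (simp add: l2norm_nonneg)

lemma partial_sums_in_l2:
  assumes n: "1 \<le> n" and \<psi>: "\<psi> \<in> l2 n"
  shows "(\<lambda>w. \<Sum>k<N. b k * (creation n 0 ^^ k) \<psi> w) \<in> l2 n"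
  unfolding sum_creation0_funpow[OF n \<psi>]
  by (rule conv_abs_in_l2[OF n \<psi>]) (rule summable_finite[of "{..<N}"], auto)

section \<open>The functional calculus\<close>

lemma HinfD:
  assumes "f \<in> Hinf"
  shows "cmod z < 1 \<Longrightarrow> (\<lambda>k. taylor_coeff f k * z ^ k) sums f z"
    and "f holomorphic_on ball 0 1"
    and "\<exists>M. \<forall>z. cmod z < 1 \<longrightarrow> cmod (f z) \<le> M"
proof -
  show h: "f holomorphic_on ball 0 1" using assms by (simp add: Hinf_def)
  show "(\<lambda>k. taylor_coeff f k * z ^ k) sums f z" if "cmod z < 1"
    using holomorphic_power_series[OF h, of z] that by (simp add: taylor_coeff_def)
  show "\<exists>M. \<forall>z. cmod z < 1 \<longrightarrow> cmod (f z) \<le> M"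
    using assms by (fastforce simp: Hinf_def bounded_iff)
qed

text \<open>Intertwining with the contractions \<open>\<psi> w \<mapsto> r\<^sup>m \<psi> w\<close>, where m counts leading zeros, reduces the limit
  \<open>r \<rightarrow> 1\<close> of \<open>f(r S\<^sub>1)\<close> to that of these diagonal operators.\<close>

lemma conv_dilation:
  "of_real r ^ lead0 w * conv a \<psi> w = conv (\<lambda>k. a k * of_real r ^ k) (\<lambda>w. of_real r ^ lead0 w * \<psi> w) w"
  unfolding conv_def sum_distrib_left
proof (rule sum.cong)
  fix k assume "k \<in> {..lead0 w}"
  then have "complex_of_real r ^ lead0 w = of_real r ^ k * of_real r ^ (lead0 w - k)"
    by (simp flip: power_add)
  then show "of_real r ^ lead0 w * (a k * \<psi> (drop k w)) =
      a k * of_real r ^ k * (of_real r ^ lead0 (drop k w) * \<psi> (drop k w))"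
    using \<open>k \<in> _\<close> by (simp add: lead0_drop)
qed simp

context
  fixes n :: nat and a :: "nat \<Rightarrow> complex" and M :: real
  assumes n: "1 \<le> n"
    and sa: "\<And>z. cmod z < 1 \<Longrightarrow> summable (\<lambda>k. a k * z ^ k)"
    and bd: "\<And>z. cmod z < 1 \<Longrightarrow> cmod (\<Sum>k. a k * z ^ k) \<le> M"
begin

lemma dilated_abs_summable:
  assumes "0 \<le> r" "r < 1"
  shows "summable (\<lambda>k. cmod (a k * complex_of_real r ^ k))"
proof -
  have "summable (\<lambda>k. norm (a k * complex_of_real r ^ k))"
    by (rule powser_insidea[where x="complex_of_real ((1 + r) / 2)"])
       (use assms in \<open>auto intro!: sa simp del: of_real_divide of_real_add\<close>)
  then show ?thesis by simp
qed

lemma conv_dilated_tendsto: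
  assumes \<psi>: "\<psi> \<in> l2 n"
  shows "l2_tendsto (\<lambda>r. conv (\<lambda>k. a k * complex_of_real r ^ k) \<psi>) (conv a \<psi>) (at_left 1)"
proof -
  have M0: "M \<ge> 0" by (rule order_trans[OF norm_ge_zero bd[of 0]]) simp
  define c where "c r w = complex_of_real r ^ lead0 w - 1" for r w
  have r01: "\<forall>\<^sub>F r in at_left (1::real). 0 < r \<and> r < 1"
    by (rule eventually_at_leftI[of 0]) auto
  have clim: "((\<lambda>r. c r w) \<longlongrightarrow> 0) (at_left 1)" for w
  proof -
    have "((\<lambda>r. c r w) \<longlongrightarrow> complex_of_real 1 ^ lead0 w - 1) (at_left 1)"
      unfolding c_def by (intro tendsto_intros)
    then show ?thesis by simp
  qed
  have c1: "cmod (c r w) \<le> 1" if "0 < r" "r < 1" for r w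
  proof -
    have "c r w = of_real (r ^ lead0 w - 1)" by (simp add: c_def)
    moreover have "0 \<le> r ^ lead0 w" "r ^ lead0 w \<le> 1" using that by (auto simp: power_le_one)
    ultimately show ?thesis by (simp only: norm_of_real)
  qed
  have ce: "\<forall>\<^sub>F r in at_left 1. \<forall>w. cmod (c r w) \<le> 1"
    using r01 by eventually_elim (auto intro: c1)
  have conv_l2: "conv a \<psi> \<in> l2 n" by (rule conv_in_l2[OF n \<psi> sa bd])
  let ?d = "\<lambda>\<phi> r. l2norm (\<lambda>w. c r w * \<phi> w)"
  have lim: "(?d \<psi> \<longlongrightarrow> 0) (at_left 1)" "(?d (conv a \<psi>) \<longlongrightarrow> 0) (at_left 1)"
    by (rule l2norm_multiplier_tendsto_0[OF _ ce clim]; fact)+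
  let ?ar = "\<lambda>r k. a k * complex_of_real r ^ k"
  have le: "l2norm (\<lambda>w. conv (?ar r) \<psi> w - conv a \<psi> w)
      \<le> sqrt (2 * (M * ?d \<psi> r)\<^sup>2 + 2 * (?d (conv a \<psi>) r)\<^sup>2)" if r: "0 < r" "r < 1" for r
  proof -
    have \<psi>': "(\<lambda>w. c r w * \<psi> w) \<in> l2 n" if "\<psi> \<in> l2 n" for \<psi>
    proof (rule l2_boundedI(1)[OF _ l2norm_nonneg[of \<psi>]])
      fix F :: "nat list set" assume F: "finite F"
      have "(\<Sum>w\<in>F. (cmod (c r w * \<psi> w))\<^sup>2) \<le> (\<Sum>w\<in>F. (cmod (\<psi> w))\<^sup>2)"
        using c1[OF r] by (intro sum_mono power_mono) (auto simp: norm_mult intro!: mult_left_le_one_le)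
      also have "\<dots> \<le> (l2norm \<psi>)\<^sup>2" by (rule l2_sum_le[OF that F])
      finally show "(\<Sum>w\<in>F. (cmod (c r w * \<psi> w))\<^sup>2) \<le> (l2norm \<psi>)\<^sup>2" .
    qed (use l2_vanishes[OF that] in auto)
    have rz: "cmod (complex_of_real r * z) < 1" if "cmod z < 1" for z
      using r that mult_strict_mono[of r 1 "cmod z" 1] by (simp add: norm_mult)
    have b: "summable (\<lambda>k. ?ar r k * z ^ k)" "cmod (\<Sum>k. ?ar r k * z ^ k) \<le> M" if "cmod z < 1" for z
      using sa[OF rz[OF that]] bd[OF rz[OF that]] by (simp_all add: power_mult_distrib mult.assoc)
    have minus: "conv b (\<lambda>w. \<phi> w - \<phi>' w) w = conv b \<phi> w - conv b \<phi>' w" for b \<phi> \<phi>' w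
      by (simp add: conv_def right_diff_distrib sum_subtractf)
    \<comment> \<open>Let D be the diagonal operator r^m. The intertwining D conv(a) = conv(a_r) D
      gives conv(a_r) - conv(a) = (D - 1) conv(a) - conv(a_r) (D - 1). Both terms tend to 0 on
      \<psi>, because conv(a_r) is bounded by M uniformly in r.\<close>
    have eq: "conv (?ar r) \<psi> w - conv a \<psi> w = - 1 * conv (?ar r) (\<lambda>w. c r w * \<psi> w) w + c r w * conv a \<psi> w" for w
      using conv_dilation[of r w a \<psi>] by (simp add: c_def left_diff_distrib minus)
    have "l2norm (\<lambda>w. conv (?ar r) \<psi> w - conv a \<psi> w)
        \<le> sqrt (2 * (l2norm (\<lambda>w. - 1 * conv (?ar r) (\<lambda>w. c r w * \<psi> w) w))\<^sup>2 + 2 * (?d (conv a \<psi>) r)\<^sup>2)"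
      unfolding eq by (intro l2norm_add_le[where n=n] l2_smult \<psi>' conv_l2 conv_in_l2[OF n _ b] \<psi>)
    also have "l2norm (\<lambda>w. - 1 * conv (?ar r) (\<lambda>w. c r w * \<psi> w) w) = l2norm (conv (?ar r) (\<lambda>w. c r w * \<psi> w))"
      by (subst l2norm_smult) simp
    also have "sqrt (2 * (l2norm (conv (?ar r) (\<lambda>w. c r w * \<psi> w)))\<^sup>2 + 2 * (?d (conv a \<psi>) r)\<^sup>2)
        \<le> sqrt (2 * (M * ?d \<psi> r)\<^sup>2 + 2 * (?d (conv a \<psi>) r)\<^sup>2)"
      by (intro real_sqrt_le_mono add_mono mult_left_mono power_mono l2norm_conv_le[OF n \<psi>'[OF \<psi>] b] l2norm_nonneg) auto
    finally show ?thesis .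
  qed
  have "((\<lambda>r. sqrt (2 * (M * ?d \<psi> r)\<^sup>2 + 2 * (?d (conv a \<psi>) r)\<^sup>2)) \<longlongrightarrow> sqrt (2 * (M * 0)\<^sup>2 + 2 * 0\<^sup>2)) (at_left 1)"
    by (intro tendsto_intros lim)
  then have lim0: "((\<lambda>r. sqrt (2 * (M * ?d \<psi> r)\<^sup>2 + 2 * (?d (conv a \<psi>) r)\<^sup>2)) \<longlongrightarrow> 0) (at_left 1)" by simp
  show ?thesis
    unfolding l2_tendsto_def
  proof (rule tendsto_sandwich[OF always_eventually _ tendsto_const lim0])
    show "\<forall>\<^sub>F r in at_left 1. l2norm (\<lambda>w. conv (?ar r) \<psi> w - conv a \<psi> w)
        \<le> sqrt (2 * (M * ?d \<psi> r)\<^sup>2 + 2 * (?d (conv a \<psi>) r)\<^sup>2)"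
      using r01 by eventually_elim (auto intro: le)
  qed (simp add: l2norm_nonneg)
qed

end

lemma Hinf_series:
  assumes "f \<in> Hinf" "\<And>z. cmod z < 1 \<Longrightarrow> cmod (f z) \<le> M"
  shows "cmod z < 1 \<Longrightarrow> summable (\<lambda>k. taylor_coeff f k * z ^ k)"
    and "cmod z < 1 \<Longrightarrow> cmod (\<Sum>k. taylor_coeff f k * z ^ k) \<le> M"
  using HinfD(1)[OF assms(1), of z] assms(2)[of z] by (auto simp: sums_iff)

lemma fun_calc_r_eq:
  assumes n: "1 \<le> n" and f: "f \<in> Hinf" and \<psi>: "\<psi> \<in> l2 n" and r: "0 \<le> r" "r < 1"
  shows "fun_calc_r n f r \<psi> = conv (\<lambda>k. taylor_coeff f k * complex_of_real r ^ k) \<psi>"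
proof -
  have s: "summable (\<lambda>k. cmod (taylor_coeff f k * complex_of_real r ^ k))"
    using HinfD(3)[OF f] Hinf_series[OF f] by (metis dilated_abs_summable[OF n _ _ r])
  show ?thesis
    unfolding fun_calc_r_def using \<psi>
    by (simp add: l2_lim_eqI[OF trivial_limit_sequentially conv_abs_in_l2[OF n \<psi> s]
          partial_sums_l2_tendsto[OF n \<psi> s]] partial_sums_in_l2[OF n \<psi>])
qed

text \<open>The limits inside \<open>fun_calc_r\<close> and \<open>fun_calc\<close> are definite
  descriptions and say nothing until a limit is exhibited. The limit found here is the
  coordinatewise series in the Taylor coefficients, and it is reached in norm on each
  vector.\<close>

lemma fun_calc_eq:
  assumes n: "1 \<le> n" and f: "f \<in> Hinf" and \<psi>: "\<psi> \<in> l2 n"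
  shows "fun_calc n f \<psi> = conv (taylor_coeff f) \<psi>"
    and "l2_tendsto (\<lambda>r. fun_calc_r n f r \<psi>) (fun_calc n f \<psi>) (at_left 1)"
proof -
  obtain M where "\<And>z. cmod z < 1 \<Longrightarrow> cmod (f z) \<le> M" using HinfD(3)[OF f] by blast
  note ser = Hinf_series[OF f this]
  have r01: "\<forall>\<^sub>F r in at_left (1::real). 0 \<le> r \<and> r < 1"
    by (rule eventually_at_leftI[of 0]) auto
  have ev: "\<forall>\<^sub>F r in at_left 1. conv (\<lambda>k. taylor_coeff f k * complex_of_real r ^ k) \<psi> = fun_calc_r n f r \<psi>"
    using r01 by eventually_elim (simp add: fun_calc_r_eq[OF n f \<psi>])
  have in_l2: "\<forall>\<^sub>F r in at_left 1. fun_calc_r n f r \<psi> \<in> l2 n"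
    using r01 ev
  proof eventually_elim
    case (elim r)
    then show ?case
      using conv_abs_in_l2[OF n \<psi> dilated_abs_summable[OF n ser, of r]] by simp
  qed
  have t: "l2_tendsto (\<lambda>r. fun_calc_r n f r \<psi>) (conv (taylor_coeff f) \<psi>) (at_left 1)"
    unfolding l2_tendsto_def
  proof (rule Lim_transform_eventually)
    show "((\<lambda>r. l2norm (\<lambda>w. conv (\<lambda>k. taylor_coeff f k * complex_of_real r ^ k) \<psi> w - conv (taylor_coeff f) \<psi> w))
        \<longlongrightarrow> 0) (at_left 1)"
      using conv_dilated_tendsto[OF n ser \<psi>] by (simp add: l2_tendsto_def)
  qed (rule eventually_mono[OF ev], simp)
  show e: "fun_calc n f \<psi> = conv (taylor_coeff f) \<psi>"
    unfolding fun_calc_def using \<psi>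
    by (simp add: l2_lim_eqI[OF _ conv_in_l2[OF n \<psi> ser] t in_l2])
  show "l2_tendsto (\<lambda>r. fun_calc_r n f r \<psi>) (fun_calc n f \<psi>) (at_left 1)" using t e by simp
qed

section \<open>Membership of f(S_1) in the algebra\<close>

lemma alg_gen_in_l2: "A \<in> alg_gen n \<Longrightarrow> \<psi> \<in> l2 n \<Longrightarrow> A \<psi> \<in> l2 n"
  by (induction arbitrary: \<psi> rule: alg_gen.induct)
     (auto simp: id_op_def creation_in_l2 l2_add l2_smult)

text \<open>The equality is restricted to \<open>l2 n\<close> because members of
  \<open>alg_gen\<close> vanish elsewhere, whereas the zeroth power of \<open>creation n 0\<close>
  is the plain identity map.\<close>

lemma polynomial_in_alg_gen:
  assumes n: "1 \<le> n"
  shows "\<exists>B\<in>alg_gen n. \<forall>\<psi>\<in>l2 n. B \<psi> = (\<lambda>w. \<Sum>k<N. b k * (creation n 0 ^^ k) \<psi> w)"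
proof -
  have pow: "\<exists>B\<in>alg_gen n. \<forall>\<psi>\<in>l2 n. B \<psi> = (creation n 0 ^^ k) \<psi>" for k
  proof (induction k)
    case 0
    show ?case by (rule bexI[OF _ gen_id]) (simp add: id_op_def)
  next
    case (Suc k)
    then obtain B where B: "B \<in> alg_gen n" "\<forall>\<psi>\<in>l2 n. B \<psi> = (creation n 0 ^^ k) \<psi>" by blast
    show ?case
      by (rule bexI[OF _ gen_comp[OF gen_S[of 0] B(1)]]) (use B n in auto)
  qed
  show ?thesis
  proof (induction N)
    case 0
    show ?case by (rule bexI[OF _ gen_smult[OF gen_id, where c=0]]) simp
  next
    case (Suc N)
    then obtain B where B: "B \<in> alg_gen n" "\<forall>\<psi>\<in>l2 n. B \<psi> = (\<lambda>w. \<Sum>k<N. b k * (creation n 0 ^^ k) \<psi> w)" by blast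
    obtain C where C: "C \<in> alg_gen n" "\<forall>\<psi>\<in>l2 n. C \<psi> = (creation n 0 ^^ N) \<psi>" using pow by blast
    show ?case
      by (rule bexI[OF _ gen_add[OF B(1) gen_smult[OF C(1), of "b N"]]]) (use B C in auto)
  qed
qed

lemma l2_tendsto_inner:
  assumes t: "l2_tendsto X L F" and "\<forall>\<^sub>F t in F. X t \<in> l2 n" "L \<in> l2 n" "\<phi> \<in> l2 n" "0 < \<epsilon>"
  shows "\<forall>\<^sub>F t in F. cmod (l2inner L \<phi> - l2inner (X t) \<phi>) < \<epsilon>"
proof -
  have "((\<lambda>t. l2norm (\<lambda>w. X t w - L w) * l2norm \<phi>) \<longlongrightarrow> 0) F"
    using t unfolding l2_tendsto_def by (rule tendsto_mult_left_zero)
  then have "\<forall>\<^sub>F t in F. l2norm (\<lambda>w. X t w - L w) * l2norm \<phi> < \<epsilon>" using assms(5) by (rule order_tendstoD(2))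
  with assms(2) show ?thesis
  proof eventually_elim
    case (elim t)
    have "cmod (l2inner L \<phi> - l2inner (X t) \<phi>) = cmod (l2inner (X t) \<phi> - l2inner L \<phi>)" by (rule norm_minus_commute)
    also have "\<dots> \<le> l2norm (\<lambda>w. X t w - L w) * l2norm \<phi>"
      using elim assms cmod_l2inner_le[OF l2_diff[of "X t" n L] assms(4)] l2inner_diff[of "X t" n L \<phi>] by simp
    finally show ?case using elim by simp
  qed
qed

text \<open>Two approximations with tolerance \<epsilon> / 2 each: f(S_1) by f(r S_1), and that by a
  polynomial in S_1. A weak neighbourhood involves finitely many pairs, so one r and then one N
  serve for all of them. The second claim is von Neumann's inequality.\<close>

lemma fun_calc_in_Fn_inf:
  assumes n: "1 \<le> n" and f: "f \<in> Hinf"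
  shows "fun_calc n f \<in> Fn_inf n"
    and "(\<And>z. cmod z < 1 \<Longrightarrow> cmod (f z) \<le> M) \<Longrightarrow> \<psi> \<in> l2 n \<Longrightarrow> l2norm (fun_calc n f \<psi>) \<le> M * l2norm \<psi>"
proof -
  obtain M0 where "\<And>z. cmod z < 1 \<Longrightarrow> cmod (f z) \<le> M0" using HinfD(3)[OF f] by blast
  note ser = Hinf_series[OF f this]
  show "l2norm (fun_calc n f \<psi>) \<le> M * l2norm \<psi>" if "\<And>z. cmod z < 1 \<Longrightarrow> cmod (f z) \<le> M" "\<psi> \<in> l2 n" for M \<psi>
    using l2norm_conv_le[OF n that(2) Hinf_series[OF f that(1)]] by (simp add: fun_calc_eq[OF n f that(2)])
  have bop: "bounded_op n (fun_calc n f)"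
    unfolding bounded_op_def
  proof (intro conjI ballI allI impI)
    show "fun_calc n f \<psi> \<in> l2 n" if "\<psi> \<in> l2 n" for \<psi>
      using conv_in_l2[OF n that ser] by (simp add: fun_calc_eq[OF n f that])
    show "fun_calc n f (\<lambda>w. a * \<psi> w + b * \<phi> w) = (\<lambda>w. a * fun_calc n f \<psi> w + b * fun_calc n f \<phi> w)"
      if "\<psi> \<in> l2 n" "\<phi> \<in> l2 n" for \<psi> \<phi> a b
      using that by (simp add: fun_calc_eq[OF n f] l2_add l2_smult)
        (auto simp: conv_def sum_distrib_left algebra_simps sum.distrib)
    show "\<exists>C. \<forall>\<psi>\<in>l2 n. l2norm (fun_calc n f \<psi>) \<le> C * l2norm \<psi>"
      using l2norm_conv_le[OF n _ ser] by (auto simp: fun_calc_eq[OF n f] intro!: exI[of _ M0])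
    show "fun_calc n f \<psi> = zero_vec" if "\<psi> \<notin> l2 n" for \<psi>
      using that by (simp add: fun_calc_def)
  qed
  show "fun_calc n f \<in> Fn_inf n"
    unfolding Fn_inf_def wot_closure_def
  proof (intro CollectI conjI bop allI impI; elim conjE)
    fix P :: "(vec \<times> vec) set" and \<epsilon> :: real
    assume P: "finite P" "P \<subseteq> l2 n \<times> l2 n" and \<epsilon>: "0 < \<epsilon>"
    have r01: "\<forall>\<^sub>F r in at_left (1::real). 0 \<le> r \<and> r < 1"
      by (rule eventually_at_leftI[of 0]) auto
    have rl2: "fun_calc_r n f r x \<in> l2 n" if "0 \<le> r" "r < 1" "x \<in> l2 n" for r x
      using conv_abs_in_l2[OF n that(3) dilated_abs_summable[OF n ser that(1,2)]]
      by (simp add: fun_calc_r_eq[OF n f that(3,1,2)])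
    have "\<forall>\<^sub>F r in at_left 1. \<forall>(x, y)\<in>P. cmod (l2inner (fun_calc n f x) y - l2inner (fun_calc_r n f r x) y) < \<epsilon> / 2"
    proof (intro eventually_ball_finite P ballI; clarify)
      fix x y assume "(x, y) \<in> P"
      then have xy: "x \<in> l2 n" "y \<in> l2 n" using P by auto
      have "\<forall>\<^sub>F r in at_left 1. fun_calc_r n f r x \<in> l2 n"
        using r01 by eventually_elim (auto intro: rl2 xy)
      then show "\<forall>\<^sub>F r in at_left 1. cmod (l2inner (fun_calc n f x) y - l2inner (fun_calc_r n f r x) y) < \<epsilon> / 2"
        using \<epsilon> bop xy by (intro l2_tendsto_inner[where n=n] fun_calc_eq n f) (auto simp: bounded_op_def)
    qed
    then have "\<forall>\<^sub>F r in at_left (1::real). (0 \<le> r \<and> r < 1) \<and>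
        (\<forall>(x, y)\<in>P. cmod (l2inner (fun_calc n f x) y - l2inner (fun_calc_r n f r x) y) < \<epsilon> / 2)"
      using r01 by eventually_elim simp
    then obtain r where r: "0 \<le> r" "r < 1"
      and 1: "\<forall>(x, y)\<in>P. cmod (l2inner (fun_calc n f x) y - l2inner (fun_calc_r n f r x) y) < \<epsilon> / 2"
      using eventually_happens'[OF trivial_limit_at_left_real] by blast
    let ?b = "\<lambda>k. taylor_coeff f k * complex_of_real r ^ k"
    let ?X = "\<lambda>x N w. \<Sum>k<N. ?b k * (creation n 0 ^^ k) x w"
    have "\<forall>\<^sub>F N in sequentially. \<forall>(x, y)\<in>P. cmod (l2inner (fun_calc_r n f r x) y - l2inner (?X x N) y) < \<epsilon> / 2"
    proof (intro eventually_ball_finite P ballI; clarify)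
      fix x y assume "(x, y) \<in> P"
      then have xy: "x \<in> l2 n" "y \<in> l2 n" using P by auto
      show "\<forall>\<^sub>F N in sequentially. cmod (l2inner (fun_calc_r n f r x) y - l2inner (?X x N) y) < \<epsilon> / 2"
      proof (rule l2_tendsto_inner[where n=n])
        show "l2_tendsto (?X x) (fun_calc_r n f r x) sequentially"
          unfolding fun_calc_r_eq[OF n f xy(1) r]
          by (rule partial_sums_l2_tendsto[OF n xy(1) dilated_abs_summable[OF n ser r]])
      qed (use \<epsilon> xy r rl2 partial_sums_in_l2[OF n] in auto)
    qed
    then obtain N where 2: "\<forall>(x, y)\<in>P. cmod (l2inner (fun_calc_r n f r x) y - l2inner (?X x N) y) < \<epsilon> / 2"
      using eventually_happens'[OF sequentially_bot] by blast
    obtain B where B: "B \<in> alg_gen n" "\<forall>\<psi>\<in>l2 n. B \<psi> = ?X \<psi> N" using polynomial_in_alg_gen[OF n, of ?b N] by blast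
    show "\<exists>B\<in>alg_gen n. \<forall>(x, y)\<in>P. cmod (l2inner (fun_calc n f x) y - l2inner (B x) y) < \<epsilon>"
    proof (intro bexI[OF _ B(1)] ballI; clarify)
      fix x y assume xy: "(x, y) \<in> P"
      then have "B x = ?X x N" using B(2) P by auto
      then show "cmod (l2inner (fun_calc n f x) y - l2inner (B x) y) < \<epsilon>"
        using norm_triangle_lt[of "l2inner (fun_calc n f x) y - l2inner (fun_calc_r n f r x) y"
            "l2inner (fun_calc_r n f r x) y - l2inner (B x) y" \<epsilon>] bspec[OF 1 xy] bspec[OF 2 xy] by simp
    qed
  qed
qed

section \<open>Commutation with right creation operators\<close>

definition right_creation :: "nat \<Rightarrow> vec \<Rightarrow> vec" where
  "right_creation i \<psi> w = (if w \<noteq> [] \<and> last w = i then \<psi> (butlast w) else 0)"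

lemma right_creation_in_l2:
  assumes "i < n" "\<psi> \<in> l2 n"
  shows "right_creation i \<psi> \<in> l2 n"
proof (rule l2_pushforward[OF assms(2), of "\<lambda>w. w @ [i]"])
  show "right_creation i \<psi> w = 0" if "w \<notin> range (\<lambda>w. w @ [i])" for w
    using that by (cases w rule: rev_cases) (auto simp: right_creation_def)
qed (use assms in \<open>auto simp: right_creation_def words_def inj_def\<close>)

lemma alg_gen_right_creation:
  assumes "A \<in> alg_gen n" "\<psi> \<in> l2 n" "i < n"
  shows "A (right_creation i \<psi>) = right_creation i (A \<psi>)"
  using assms(1,2)
proof (induction arbitrary: \<psi> rule: alg_gen.induct)
  case gen_id
  then show ?case using assms(3) by (simp add: id_op_def right_creation_in_l2)
next
  case (gen_S j)
  show ?case
  proof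
    fix w
    show "creation n j (right_creation i \<psi>) w = right_creation i (creation n j \<psi>) w"
      using gen_S assms(3) right_creation_in_l2[of i n \<psi>]
      by (cases w) (auto simp: creation_def right_creation_def)
  qed
next
  case (gen_comp A B)
  then show ?case by (simp add: alg_gen_in_l2)
qed (auto simp: right_creation_def fun_eq_iff)

lemma words_butlast: "w \<in> words n \<Longrightarrow> butlast w \<in> words n"
  by (auto simp: words_def dest: in_set_butlastD)

lemma Fn_infD: "T \<in> Fn_inf n \<Longrightarrow> bounded_op n T"
  by (simp add: Fn_inf_def wot_closure_def)

lemma Fn_inf_approx:
  assumes "T \<in> Fn_inf n" "finite P" "P \<subseteq> l2 n \<times> l2 n" "0 < \<epsilon>"
  shows "\<exists>B\<in>alg_gen n. \<forall>(x, y)\<in>P. cmod (l2inner (T x) y - l2inner (B x) y) < \<epsilon>"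
  using assms unfolding Fn_inf_def wot_closure_def by blast

lemma bounded_opD:
  assumes "bounded_op n T"
  shows "\<psi> \<in> l2 n \<Longrightarrow> T \<psi> \<in> l2 n"
    and "\<psi> \<in> l2 n \<Longrightarrow> \<phi> \<in> l2 n \<Longrightarrow> T (\<lambda>w. a * \<psi> w + b * \<phi> w) = (\<lambda>w. a * T \<psi> w + b * T \<phi> w)"
    and "\<exists>C. \<forall>\<psi>\<in>l2 n. l2norm (T \<psi>) \<le> C * l2norm \<psi>"
    and "\<psi> \<notin> l2 n \<Longrightarrow> T \<psi> = zero_vec"
  using assms unfolding bounded_op_def by blast+

lemma Fn_inf_right_creation:
  assumes T: "T \<in> Fn_inf n" and \<psi>: "\<psi> \<in> l2 n" and i: "i < n"
  shows "T (right_creation i \<psi>) = right_creation i (T \<psi>)"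
proof
  fix w
  let ?R = "right_creation i"
  have R\<psi>: "?R \<psi> \<in> l2 n" by (rule right_creation_in_l2[OF i \<psi>])
  note T' = Fn_infD[OF T]
  show "T (?R \<psi>) w = ?R (T \<psi>) w"
  proof (cases "w \<in> words n")
    case False
    then show ?thesis
      using l2_vanishes[OF bounded_opD(1)[OF T' R\<psi>]]
        l2_vanishes[OF right_creation_in_l2[OF i bounded_opD(1)[OF T' \<psi>]]] by simp
  next
    case True
    \<comment> \<open>Coordinate w of R(T \<psi>) is either 0 or coordinate \<open>butlast w\<close>
      of T \<psi>. Hence two matrix entries suffice to test commutation, and a single B close to T
      in both transfers it from the generated algebra.\<close>
    let ?P = "{(?R \<psi>, delta w), (\<psi>, delta (butlast w))}"
    have P: "finite ?P" "?P \<subseteq> l2 n \<times> l2 n"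
      using R\<psi> \<psi> l2_delta[OF True] l2_delta[OF words_butlast[OF True]] by auto
    have "cmod (T (?R \<psi>) w - ?R (T \<psi>) w) \<le> \<epsilon>" if "0 < \<epsilon>" for \<epsilon>
    proof -
      have "\<exists>B\<in>alg_gen n. \<forall>(x, y)\<in>?P. cmod (l2inner (T x) y - l2inner (B x) y) < \<epsilon> / 2"
        by (rule Fn_inf_approx[OF T P]) (use that in simp)
      then obtain B where B: "B \<in> alg_gen n"
        and "\<forall>(x, y)\<in>?P. cmod (l2inner (T x) y - l2inner (B x) y) < \<epsilon> / 2" by blast
      then have 1: "cmod (T (?R \<psi>) w - B (?R \<psi>) w) < \<epsilon> / 2"
        and 2: "cmod (T \<psi> (butlast w) - B \<psi> (butlast w)) < \<epsilon> / 2"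
        by (simp_all add: l2inner_delta)
      have "cmod (?R (B \<psi>) w - ?R (T \<psi>) w) < \<epsilon> / 2"
        using 2 that by (auto simp: right_creation_def norm_minus_commute)
      then show ?thesis
        using 1 norm_triangle_ineq[of "T (?R \<psi>) w - B (?R \<psi>) w" "?R (B \<psi>) w - ?R (T \<psi>) w"]
        by (simp add: alg_gen_right_creation[OF B \<psi> i])
    qed
    then show ?thesis using field_le_epsilon[of "cmod (T (?R \<psi>) w - ?R (T \<psi>) w)" 0] by simp
  qed
qed

text \<open>Every basis vector arises from the vacuum by right creations, letter by letter, so A and
  B agree on each \<open>delta u\<close>. Linearity and boundedness extend this to
  \<open>l2 n\<close>; off \<open>l2 n\<close> both are zero by convention.\<close>

lemma Fn_inf_eqI:
  assumes A: "A \<in> Fn_inf n" and B: "B \<in> Fn_inf n" and eq: "A (delta []) = B (delta [])"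
  shows "A = B"
proof
  note A' = bounded_opD[OF Fn_infD[OF A]] and B' = bounded_opD[OF Fn_infD[OF B]]
  have e: "A (delta u) = B (delta u)" if "u \<in> words n" for u
    using that
  proof (induction u rule: rev_induct)
    case (snoc i u)
    then have u: "u \<in> words n" "i < n" by (auto simp: words_def)
    have "delta (u @ [i]) = right_creation i (delta u)"
      by (auto simp: right_creation_def fun_eq_iff)
    then show ?case
      using snoc.IH[OF u(1)] Fn_inf_right_creation[OF A l2_delta[OF u(1)] u(2)]
        Fn_inf_right_creation[OF B l2_delta[OF u(1)] u(2)] by simp
  qed (use eq in simp)
  fix \<psi>
  show "A \<psi> = B \<psi>"
  proof (cases "\<psi> \<in> l2 n")
    case \<psi>: True
    \<comment> \<open>\<open>t F\<close> is \<psi> cut down to F and \<open>c F\<close> is the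
      indicator of the complement. Linearity settles the finite part, the bounds C1 and C2 make the
      remainder small.\<close>
    define t where "t F w = (if w \<in> F then \<psi> w else 0)" for F w
    define c where "c F w = (if w \<in> F then 0 else 1 :: complex)" for F and w :: "nat list"
    have tin: "t F \<in> l2 n" and cin: "(\<lambda>w. c F w * \<psi> w) \<in> l2 n" for F
    proof -
      have "(\<Sum>w\<in>G. (cmod (t F w))\<^sup>2) \<le> (l2norm \<psi>)\<^sup>2" "(\<Sum>w\<in>G. (cmod (c F w * \<psi> w))\<^sup>2) \<le> (l2norm \<psi>)\<^sup>2"
        if "finite G" for G
        by (rule order_trans[OF sum_mono l2_sum_le[OF \<psi> that]]; simp add: t_def c_def)+
      then show "t F \<in> l2 n" "(\<lambda>w. c F w * \<psi> w) \<in> l2 n"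
        by (auto intro!: l2_boundedI(1)[OF _ l2norm_nonneg[of \<psi>]] simp: t_def c_def l2_vanishes[OF \<psi>])
    qed
    have AB: "A (t F) = B (t F)" if "finite F" for F
      using that
    proof (induction F rule: finite_induct)
      case empty
      have "t {} = (\<lambda>w. 0 * \<psi> w + 0 * \<psi> w)" by (simp add: t_def fun_eq_iff)
      then show ?case using A'(2)[OF \<psi> \<psi>, of 0 0] B'(2)[OF \<psi> \<psi>, of 0 0] by simp
    next
      case (insert v F)
      show ?case
      proof (cases "v \<in> words n")
        case True
        have "t (insert v F) = (\<lambda>w. 1 * t F w + \<psi> v * delta v w)"
          using insert.hyps by (auto simp: t_def fun_eq_iff)
        then show ?thesis
          using A'(2)[OF tin l2_delta[OF True], of 1 F "\<psi> v"] B'(2)[OF tin l2_delta[OF True], of 1 F "\<psi> v"]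
            e[OF True] insert.IH by simp
      next
        case False
        then have "t (insert v F) = t F" using l2_vanishes[OF \<psi> False] by (auto simp: t_def fun_eq_iff)
        then show ?thesis using insert.IH by simp
      qed
    qed
    obtain C1 C2 where C: "\<And>\<phi>. \<phi> \<in> l2 n \<Longrightarrow> l2norm (A \<phi>) \<le> C1 * l2norm \<phi>" "\<And>\<phi>. \<phi> \<in> l2 n \<Longrightarrow> l2norm (B \<phi>) \<le> C2 * l2norm \<phi>"
      using A'(3) B'(3) by blast
    have lim: "((\<lambda>F. l2norm (\<lambda>w. c F w * \<psi> w)) \<longlongrightarrow> 0) (finite_subsets_at_top UNIV)"
    proof (rule l2norm_multiplier_tendsto_0[OF \<psi>])
      show "((\<lambda>F. c F w) \<longlongrightarrow> 0) (finite_subsets_at_top UNIV)" for w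
        by (rule tendsto_eventually)
           (auto simp: eventually_finite_subsets_at_top c_def intro!: exI[of _ "{w}"])
    qed (simp add: c_def)
    have lim': "((\<lambda>F. (C1 + C2) * l2norm (\<lambda>w. c F w * \<psi> w)) \<longlongrightarrow> 0) (finite_subsets_at_top UNIV)"
      using tendsto_mult_right_zero[OF lim] .
    have "cmod (A \<psi> u - B \<psi> u) \<le> 0" for u
    proof (rule tendsto_lowerbound[OF lim'])
      show "\<forall>\<^sub>F F in finite_subsets_at_top UNIV. cmod (A \<psi> u - B \<psi> u) \<le> (C1 + C2) * l2norm (\<lambda>w. c F w * \<psi> w)"
      proof (rule eventually_finite_subsets_at_top_weakI)
        fix F :: "nat list set" assume F: "finite F"
        have \<psi>eq: "\<psi> = (\<lambda>w. 1 * t F w + 1 * (c F w * \<psi> w))" by (auto simp: t_def c_def fun_eq_iff)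
        let ?q = "\<lambda>w. c F w * \<psi> w"
        have "A \<psi> u = A (t F) u + A ?q u" "B \<psi> u = B (t F) u + B ?q u"
          using arg_cong[OF \<psi>eq, of "\<lambda>\<psi>. A \<psi> u"] arg_cong[OF \<psi>eq, of "\<lambda>\<psi>. B \<psi> u"]
            A'(2)[OF tin cin, of 1 F 1 F] B'(2)[OF tin cin, of 1 F 1 F] by simp_all
        then have "cmod (A \<psi> u - B \<psi> u) = cmod (A ?q u - B ?q u)" using AB[OF F] by simp
        also have "\<dots> \<le> cmod (A ?q u) + cmod (B ?q u)" by (rule norm_triangle_ineq4)
        also have "\<dots> \<le> l2norm (A ?q) + l2norm (B ?q)"
          by (intro add_mono l2_component_le[of _ n] A'(1) B'(1) cin)
        also have "\<dots> \<le> (C1 + C2) * l2norm ?q"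
          using C[OF cin[of F]] by (simp add: distrib_right)
        finally show "cmod (A \<psi> u - B \<psi> u) \<le> (C1 + C2) * l2norm ?q" .
      qed
    qed simp
    then show ?thesis by (auto simp: fun_eq_iff)
  qed (simp add: A'(4) B'(4))
qed

section \<open>Contractions and test vectors\<close>

lemma opnorm_le_1D:
  assumes T: "bounded_op n T" "opnorm n T \<le> 1" and \<psi>: "\<psi> \<in> l2 n"
  shows "l2norm (T \<psi>) \<le> l2norm \<psi>"
proof -
  obtain C where C: "\<And>\<psi>. \<psi> \<in> l2 n \<Longrightarrow> l2norm (T \<psi>) \<le> C * l2norm \<psi>" using bounded_opD(3)[OF T(1)] by blast
  show ?thesis
  proof (cases "l2norm \<psi> = 0")
    case True
    then show ?thesis using C[OF \<psi>] by simp
  next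
    case False
    then have p: "l2norm \<psi> > 0" using l2norm_nonneg[of \<psi>] by simp
    let ?S = "{l2norm (T \<psi>) | \<psi>. \<psi> \<in> l2 n \<and> l2norm \<psi> \<le> 1}"
    let ?a = "complex_of_real (1 / l2norm \<psi>)"
    \<comment> \<open>\<open>Sup\<close> of an unbounded set of reals is unspecified; the bound on T
      makes it an actual supremum.\<close>
    have bdd: "bdd_above ?S"
    proof (rule bdd_aboveI[of _ "\<bar>C\<bar>"])
      fix x assume "x \<in> ?S"
      then obtain \<phi> where \<phi>: "x = l2norm (T \<phi>)" "\<phi> \<in> l2 n" "l2norm \<phi> \<le> 1" by blast
      have "x \<le> \<bar>C\<bar> * l2norm \<phi>"
        using C[OF \<phi>(2)] \<phi>(1) mult_right_mono[OF abs_ge_self[of C] l2norm_nonneg[of \<phi>]] by linarith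
      also have "\<dots> \<le> \<bar>C\<bar>" using \<phi>(3) by (simp add: mult_left_le)
      finally show "x \<le> \<bar>C\<bar>" .
    qed
    have Teq: "T (\<lambda>w. ?a * \<psi> w) = (\<lambda>w. ?a * T \<psi> w)"
      using bounded_opD(2)[OF T(1) \<psi> \<psi>, of ?a 0] by simp
    have "l2norm (\<lambda>w. ?a * \<psi> w) \<le> 1"
      unfolding l2norm_smult using p by (simp add: norm_divide)
    then have "l2norm (T (\<lambda>w. ?a * \<psi> w)) \<in> ?S" using l2_smult[OF \<psi>] by blast
    then have "l2norm (T (\<lambda>w. ?a * \<psi> w)) \<le> 1"
      using cSup_upper[OF _ bdd] T(2) unfolding opnorm_def by force
    then have "l2norm (T \<psi>) / l2norm \<psi> \<le> 1" unfolding Teq l2norm_smult using p by (simp add: norm_divide)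
    then show ?thesis using p by (simp add: divide_le_eq_1)
  qed
qed

lemma opnorm_le_1I:
  assumes "\<And>\<psi>. \<psi> \<in> l2 n \<Longrightarrow> l2norm (T \<psi>) \<le> l2norm \<psi>"
  shows "opnorm n T \<le> 1"
  unfolding opnorm_def
proof (rule cSup_least)
  show "{l2norm (T \<psi>) | \<psi>. \<psi> \<in> l2 n \<and> l2norm \<psi> \<le> 1} \<noteq> {}"
    using l2_zero by (auto intro!: exI[of _ "\<lambda>w. 0"])
qed (use assms in force)

text \<open>The Szego kernel on the copy of the Hardy space spanned by the words \<open>0\<^sup>m\<close>.\<close>

definition kernel_vec :: "complex \<Rightarrow> vec" where
  "kernel_vec z w = (if w = replicate (length w) 0 then cnj z ^ length w else 0)"

lemma kernel_vec:
  assumes n: "1 \<le> n" and z: "cmod z < 1"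
  shows kernel_vec_in_l2: "kernel_vec z \<in> l2 n"
    and l2norm_kernel_vec: "(l2norm (kernel_vec z))\<^sup>2 = 1 / (1 - (cmod z)\<^sup>2)"
proof -
  let ?j = "\<lambda>m. replicate m (0::nat)"
  have "(\<lambda>m. ((cmod z)\<^sup>2) ^ m) sums (1 / (1 - (cmod z)\<^sup>2))"
    by (rule geometric_sums) (use z in \<open>simp add: power_less_one_iff abs_square_less_1\<close>)
  then have "((\<lambda>m. ((cmod z)\<^sup>2) ^ m) has_sum (1 / (1 - (cmod z)\<^sup>2))) UNIV"
    by (rule sums_nonneg_imp_has_sum) simp
  moreover have "(\<lambda>m. ((cmod z)\<^sup>2) ^ m) = (\<lambda>w. (cmod (kernel_vec z w))\<^sup>2) \<circ> ?j"
    by (auto simp: kernel_vec_def fun_eq_iff norm_power mult.commute simp flip: power_mult)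
  moreover have "inj ?j" by (rule injI) (metis length_replicate)
  ultimately have "((\<lambda>w. (cmod (kernel_vec z w))\<^sup>2) has_sum (1 / (1 - (cmod z)\<^sup>2))) (range ?j)"
    by (simp only: has_sum_reindex)
  then have hs: "((\<lambda>w. (cmod (kernel_vec z w))\<^sup>2) has_sum (1 / (1 - (cmod z)\<^sup>2))) UNIV"
    by (rule has_sum_cong_neutral[THEN iffD1, rotated 3]) (auto simp: kernel_vec_def)
  then show "(l2norm (kernel_vec z))\<^sup>2 = 1 / (1 - (cmod z)\<^sup>2)" by (simp add: l2norm_power2 infsumI)
  have "kernel_vec z w = 0" if "w \<notin> words n" for w
  proof -
    have "?j (length w) \<in> words n" using n by (auto simp: words_def)
    then have "w \<noteq> ?j (length w)" using that by metis
    then show ?thesis by (simp add: kernel_vec_def)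
  qed
  then show "kernel_vec z \<in> l2 n" using hs by (auto simp: l2_def has_sum_imp_summable)
qed

text \<open>The kernel is the resolvent (1 - cnj z R)^(-1) applied to the vacuum, with R right
  creation by the letter 0. Left creation would give the same vector, but R is the one that commutes
  with the algebra.\<close>

lemma kernel_vec_eq: "kernel_vec z = (\<lambda>w. 1 * delta [] w + cnj z * right_creation 0 (kernel_vec z) w)"
proof
  fix w
  show "kernel_vec z w = 1 * delta [] w + cnj z * right_creation 0 (kernel_vec z) w"
  proof (cases w rule: rev_cases)
    case (snoc u i)
    have "u @ [i] = replicate (Suc (length u)) 0 \<longleftrightarrow> i = 0 \<and> u = replicate (length u) 0"
      by (simp only: replicate_Suc replicate_append_same[symmetric] append1_eq_conv conj_commute)
    then show ?thesis by (auto simp: snoc kernel_vec_def right_creation_def)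
  qed (simp add: kernel_vec_def right_creation_def)
qed

text \<open>T is applied to the recursion of the kernel and moved past R. In this form no infinite
  sum has to be interchanged with T.\<close>

lemma Fn_inf_kernel_vec:
  assumes n: "1 \<le> n" and z: "cmod z < 1" and T: "T \<in> Fn_inf n"
  shows "T (kernel_vec z) w = T (delta []) w + cnj z * right_creation 0 (T (kernel_vec z)) w"
proof -
  have k: "kernel_vec z \<in> l2 n" by (rule kernel_vec_in_l2[OF n z])
  have d: "delta [] \<in> l2 n" by (rule l2_delta) (simp add: words_def)
  have "T (kernel_vec z) = T (\<lambda>w. 1 * delta [] w + cnj z * right_creation 0 (kernel_vec z) w)"
    using kernel_vec_eq by metis
  also have "\<dots> = (\<lambda>w. 1 * T (delta []) w + cnj z * T (right_creation 0 (kernel_vec z)) w)"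
    by (rule bounded_opD(2)[OF Fn_infD[OF T] d right_creation_in_l2[OF _ k]]) (use n in simp)
  also have "T (right_creation 0 (kernel_vec z)) = right_creation 0 (T (kernel_vec z))"
    by (rule Fn_inf_right_creation[OF T k]) (use n in simp)
  finally show ?thesis by (simp only: mult_1 fun_eq_iff)
qed

lemma bounded_coeff_summable:
  fixes a :: "nat \<Rightarrow> complex"
  assumes "\<And>j. cmod (a j) \<le> K" "cmod z < 1"
  shows "summable (\<lambda>j. cmod (a j * z ^ j))"
proof (rule summable_comparison_test'[where N=0])
  show "summable (\<lambda>j. K * cmod z ^ j)" using assms(2) by (intro summable_mult summable_geometric) simp
  show "norm (cmod (a j * z ^ j)) \<le> K * cmod z ^ j" for j
    using assms(1) by (simp add: norm_mult norm_power mult_right_mono)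
qed

text \<open>For v not ending in 0, the entries of x at \<open>v 0\<^sup>m\<close> are the Taylor coefficients of the product of
  \<open>g(\<lambda>) = \<Sum>\<^sub>j \<phi>(v 0\<^sup>j) \<lambda>\<^sup>j\<close> with the Szego kernel at z; pairing with the kernel evaluates it at z.\<close>

lemma kernel_estimate:
  assumes z: "cmod z < 1" and x: "x \<in> l2 n" and \<phi>: "\<phi> \<in> l2 n"
    and rec: "\<And>w. x w = \<phi> w + cnj z * right_creation 0 x w"
    and v: "v = [] \<or> last v \<noteq> 0"
  shows "(cmod (\<Sum>j. \<phi> (v @ replicate j 0) * z ^ j))\<^sup>2 \<le> (l2norm x)\<^sup>2 * (1 - (cmod z)\<^sup>2)"
proof -
  define a where "a j = \<phi> (v @ replicate j 0)" for j
  define y where "y m = x (v @ replicate m 0)" for m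
  have z2: "(cmod z)\<^sup>2 < 1" using z by (simp add: abs_square_less_1)
  \<comment> \<open>At m = 0 the right creation term vanishes because v does not end in 0; each
    further trailing 0 brings a factor cnj z.\<close>
  have y: "y m = (\<Sum>j\<le>m. a j * cnj z ^ (m - j))" for m
  proof (induction m)
    case 0
    show ?case using rec[of v] v by (auto simp: y_def a_def right_creation_def)
  next
    case (Suc m)
    have "y (Suc m) = a (Suc m) + cnj z * y m"
      using rec[of "v @ replicate (Suc m) 0"]
      by (simp add: y_def a_def right_creation_def butlast_append flip: replicate_append_same)
    also have "cnj z * y m = (\<Sum>j\<le>m. a j * cnj z ^ (Suc m - j))"
      unfolding Suc.IH sum_distrib_left by (intro sum.cong) (auto simp: Suc_diff_le)
    finally show ?case by simp
  qed
  have sa: "summable (\<lambda>j. cmod (a j * z ^ j))"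
    by (rule bounded_coeff_summable[OF _ z, of _ "l2norm \<phi>"]) (simp add: a_def l2_component_le[OF \<phi>])
  let ?q = "complex_of_real ((cmod z)\<^sup>2)"
  have q: "cnj z * z = ?q" by (simp add: complex_norm_square mult.commute del: of_real_power)
  have q1: "cmod ?q < 1" using z2 by (simp add: norm_power)
  \<comment> \<open>As z^m cnj(z)^(m-j) = z^j |z|^(2(m-j)), the terms y_m z^m form the Cauchy
    product of the series of g at z with the geometric series in |z|^2. Their sum is therefore g(z)
    / (1 - |z|^2).\<close>
  have "(\<lambda>m. \<Sum>j\<le>m. (a j * z ^ j) * ?q ^ (m - j)) sums ((\<Sum>j. a j * z ^ j) * (\<Sum>j. ?q ^ j))"
    by (rule Cauchy_product_sums[OF sa]) (use q1 in \<open>simp add: norm_power summable_geometric\<close>)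
  moreover have "(\<Sum>j\<le>m. (a j * z ^ j) * ?q ^ (m - j)) = y m * z ^ m" for m
  proof -
    have "(a j * z ^ j) * ?q ^ (m - j) = (a j * cnj z ^ (m - j)) * z ^ m" if "j \<le> m" for j
    proof -
      have "z ^ m = z ^ j * z ^ (m - j)" using that by (simp flip: power_add)
      then show ?thesis unfolding q[symmetric] power_mult_distrib by simp
    qed
    then show ?thesis unfolding y sum_distrib_right by (intro sum.cong) auto
  qed
  moreover have "(\<Sum>j. ?q ^ j) = 1 / (1 - ?q)" by (rule suminf_geometric[OF q1])
  ultimately have sums: "(\<lambda>m. y m * z ^ m) sums ((\<Sum>j. a j * z ^ j) / (1 - ?q))" by simp
  \<comment> \<open>Cauchy-Schwarz against the coefficients of the kernel, on partial sums; the
    second factor is bounded by the squared norm of the kernel.\<close>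
  have part: "(cmod (\<Sum>m<N. y m * z ^ m))\<^sup>2 \<le> (l2norm x)\<^sup>2 * (1 / (1 - (cmod z)\<^sup>2))" for N
  proof -
    have "cmod (\<Sum>m<N. y m * z ^ m) \<le> (\<Sum>m<N. \<bar>cmod (y m)\<bar> * \<bar>cmod z ^ m\<bar>)"
      by (rule sum_norm_le) (simp add: norm_mult norm_power)
    also have "\<dots> \<le> L2_set (\<lambda>m. cmod (y m)) {..<N} * L2_set (\<lambda>m. cmod z ^ m) {..<N}"
      by (rule L2_set_mult_ineq)
    finally have "(cmod (\<Sum>m<N. y m * z ^ m))\<^sup>2
        \<le> (L2_set (\<lambda>m. cmod (y m)) {..<N} * L2_set (\<lambda>m. cmod z ^ m) {..<N})\<^sup>2"
      by (intro power_mono) auto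
    also have "\<dots> = (\<Sum>m<N. (cmod (y m))\<^sup>2) * (\<Sum>m<N. ((cmod z)\<^sup>2) ^ m)"
      by (simp add: L2_set_def power_mult_distrib sum_nonneg mult.commute flip: power_mult)
    also have "\<dots> \<le> (l2norm x)\<^sup>2 * (1 / (1 - (cmod z)\<^sup>2))"
    proof (rule mult_mono)
      have "inj_on (\<lambda>m. v @ replicate m 0) {..<N}"
        by (rule inj_onI) (metis length_replicate same_append_eq)
      then have "(\<Sum>m<N. (cmod (y m))\<^sup>2) = (\<Sum>w\<in>(\<lambda>m. v @ replicate m 0) ` {..<N}. (cmod (x w))\<^sup>2)"
        by (simp add: sum.reindex y_def)
      also have "\<dots> \<le> (l2norm x)\<^sup>2" by (rule l2_sum_le[OF x]) simp
      finally show "(\<Sum>m<N. (cmod (y m))\<^sup>2) \<le> (l2norm x)\<^sup>2" .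
      have "(\<Sum>m<N. ((cmod z)\<^sup>2) ^ m) \<le> (\<Sum>m. ((cmod z)\<^sup>2) ^ m)"
        using z2 by (intro sum_le_suminf summable_geometric) auto
      also have "\<dots> = 1 / (1 - (cmod z)\<^sup>2)" using z2 by (intro suminf_geometric) simp
      finally show "(\<Sum>m<N. ((cmod z)\<^sup>2) ^ m) \<le> 1 / (1 - (cmod z)\<^sup>2)" .
    qed (auto intro: sum_nonneg)
    finally show ?thesis .
  qed
  have "(\<lambda>N. (cmod (\<Sum>m<N. y m * z ^ m))\<^sup>2) \<longlonglongrightarrow> (cmod ((\<Sum>j. a j * z ^ j) / (1 - ?q)))\<^sup>2"
    using sums unfolding sums_def by (intro tendsto_intros)
  then have "(cmod ((\<Sum>j. a j * z ^ j) / (1 - ?q)))\<^sup>2 \<le> (l2norm x)\<^sup>2 * (1 / (1 - (cmod z)\<^sup>2))"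
    by (rule LIMSEQ_le_const2) (use part in auto)
  moreover have "cmod (1 - ?q) = 1 - (cmod z)\<^sup>2"
    using z2 norm_of_real[of "1 - (cmod z)\<^sup>2", where 'a=complex] by simp
  \<comment> \<open>The left side carries the square of 1 / (1 - |z|^2), the right side only its
    first power. Clearing denominators leaves 1 - |z|^2, the inverse of the squared kernel
    norm.\<close>
  ultimately have "(cmod (\<Sum>j. a j * z ^ j))\<^sup>2 / (1 - (cmod z)\<^sup>2)\<^sup>2 \<le> (l2norm x)\<^sup>2 / (1 - (cmod z)\<^sup>2)"
    by (simp add: norm_divide power_divide)
  then have "(cmod (\<Sum>j. a j * z ^ j))\<^sup>2 \<le> (l2norm x)\<^sup>2 / (1 - (cmod z)\<^sup>2) * (1 - (cmod z)\<^sup>2)\<^sup>2"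
    using z2 by (subst (asm) pos_divide_le_eq) auto
  also have "\<dots> = (l2norm x)\<^sup>2 * (1 - (cmod z)\<^sup>2)" using z2 by (simp add: power2_eq_square)
  finally show ?thesis by (simp add: a_def)
qed

section \<open>Extreme points\<close>

text \<open>In the definitions of extremality the weight is compared with 0 and 1 after coercion to the
  complex numbers, whose order is the one from \<open>Complex_Order\<close>.\<close>

lemma of_real_complex_unit_interval:
  "0 < complex_of_real t \<longleftrightarrow> 0 < t" "complex_of_real t < 1 \<longleftrightarrow> t < 1"
  by (auto simp: less_complex_def)

lemma extreme_Hinf_iff:
  "extreme_Hinf f \<longleftrightarrow> f \<in> Hinf_ball \<and>
    (\<forall>g h t. g \<in> Hinf_ball \<longrightarrow> h \<in> Hinf_ball \<longrightarrow> 0 < t \<longrightarrow> t < 1 \<longrightarrow>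
      f = (\<lambda>z. (1 - complex_of_real t) * g z + complex_of_real t * h z) \<longrightarrow> g = h)"
  unfolding extreme_Hinf_def of_real_complex_unit_interval by blast

lemma extreme_Fn_iff:
  "extreme_Fn n T \<longleftrightarrow> T \<in> Fn_ball n \<and>
    (\<forall>A B t. A \<in> Fn_ball n \<longrightarrow> B \<in> Fn_ball n \<longrightarrow> 0 < t \<longrightarrow> t < 1 \<longrightarrow>
      T = (\<lambda>\<psi> w. (1 - complex_of_real t) * A \<psi> w + complex_of_real t * B \<psi> w) \<longrightarrow> A = B)"
  unfolding extreme_Fn_def of_real_complex_unit_interval by blast

section \<open>Linearity, injectivity and unit balls under the functional calculus\<close>

lemma fun_calc_vacuum:
  assumes n: "1 \<le> n" and f: "f \<in> Hinf"
  shows "fun_calc n f (delta []) (replicate j 0) = taylor_coeff f j"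
proof -
  have d: "delta [] \<in> l2 n" by (rule l2_delta) (simp add: words_def)
  have "fun_calc n f (delta []) (replicate j 0) = (\<Sum>k\<le>j. taylor_coeff f k * delta [] (replicate (j - k) 0))"
    using lead0_append[of "[]" j] by (simp add: fun_calc_eq(1)[OF n f d] conv_def)
  also have "\<dots> = (\<Sum>k\<le>j. if k = j then taylor_coeff f k else 0)" by (intro sum.cong) auto
  finally show ?thesis by simp
qed

lemma fun_calc_inj:
  assumes n: "1 \<le> n" and g: "g \<in> Hinf" and h: "h \<in> Hinf" and eq: "fun_calc n g = fun_calc n h"
  shows "g = h"
proof
  fix z
  have "taylor_coeff g = taylor_coeff h"
    using eq fun_calc_vacuum[OF n g] fun_calc_vacuum[OF n h] by (auto simp: fun_eq_iff)
  then show "g z = h z"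
    using HinfD(1)[OF g, of z] HinfD(1)[OF h, of z] g h
    by (cases "cmod z < 1") (auto simp: Hinf_def dest: sums_unique2)
qed

lemma fun_calc_lincomb:
  assumes n: "1 \<le> n" and f: "f \<in> Hinf" and g: "g \<in> Hinf" and h: "h \<in> Hinf"
    and eq: "f = (\<lambda>z. a * g z + b * h z)"
  shows "fun_calc n f = (\<lambda>\<psi> w. a * fun_calc n g \<psi> w + b * fun_calc n h \<psi> w)"
proof (intro ext)
  fix \<psi> w
  have tc: "taylor_coeff f k = a * taylor_coeff g k + b * taylor_coeff h k" for k
  proof -
    have hol: "(\<lambda>z. a * g z) holomorphic_on ball 0 1" "(\<lambda>z. b * h z) holomorphic_on ball 0 1"
      using HinfD(2)[OF g] HinfD(2)[OF h] by (auto intro!: holomorphic_intros)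
    show ?thesis
      unfolding taylor_coeff_def eq
      by (simp add: higher_deriv_add[OF hol] higher_deriv_cmult[OF HinfD(2)[OF g]]
          higher_deriv_cmult[OF HinfD(2)[OF h]] add_divide_distrib)
  qed
  show "fun_calc n f \<psi> w = a * fun_calc n g \<psi> w + b * fun_calc n h \<psi> w"
  proof (cases "\<psi> \<in> l2 n")
    case True
    then show ?thesis
      by (simp add: fun_calc_eq(1)[OF n] f g h conv_def tc sum_distrib_left sum.distrib algebra_simps)
  qed (simp add: fun_calc_def zero_vec_def)
qed

lemma fun_calc_in_Fn_ball:
  assumes n: "1 \<le> n" and f: "f \<in> Hinf_ball"
  shows "fun_calc n f \<in> Fn_ball n"
proof -
  have f': "f \<in> Hinf" "\<And>z. cmod z < 1 \<Longrightarrow> cmod (f z) \<le> 1" using f by (auto simp: Hinf_ball_def)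
  have "l2norm (fun_calc n f \<psi>) \<le> l2norm \<psi>" if "\<psi> \<in> l2 n" for \<psi>
    using fun_calc_in_Fn_inf(2)[OF n f'(1,2) that] by simp
  then show ?thesis
    using fun_calc_in_Fn_inf(1)[OF n f'(1)] by (simp add: Fn_ball_def opnorm_le_1I)
qed

lemma Fn_ballD:
  assumes "A \<in> Fn_ball n"
  shows "A \<in> Fn_inf n" and "\<psi> \<in> l2 n \<Longrightarrow> A \<psi> \<in> l2 n" and "\<psi> \<in> l2 n \<Longrightarrow> l2norm (A \<psi>) \<le> l2norm \<psi>"
  using assms Fn_infD[of A n] by (auto simp: Fn_ball_def bounded_opD opnorm_le_1D)

text \<open>The case v = [] for T = f(S_1): the image of the vacuum has the Taylor coefficients of f
  at the words 0^j, so the entry of the column is f itself. With k the kernel this reads |f(z)| <=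
  |f(S_1) k| / |k|, the bound opposite to von Neumann's.\<close>

lemma fun_calc_kernel_estimate:
  assumes n: "1 \<le> n" and f: "f \<in> Hinf" and z: "cmod z < 1"
  shows "(cmod (f z))\<^sup>2 \<le> (l2norm (fun_calc n f (kernel_vec z)))\<^sup>2 * (1 - (cmod z)\<^sup>2)"
proof -
  have d: "delta [] \<in> l2 n" by (rule l2_delta) (simp add: words_def)
  note T = fun_calc_in_Fn_inf(1)[OF n f]
  have "f z = (\<Sum>j. fun_calc n f (delta []) ([] @ replicate j 0) * z ^ j)"
    using HinfD(1)[OF f z] by (simp add: fun_calc_vacuum[OF n f] sums_iff)
  moreover have "(cmod (\<Sum>j. fun_calc n f (delta []) ([] @ replicate j 0) * z ^ j))\<^sup>2
      \<le> (l2norm (fun_calc n f (kernel_vec z)))\<^sup>2 * (1 - (cmod z)\<^sup>2)"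
    by (rule kernel_estimate[where n=n, OF z _ _ Fn_inf_kernel_vec[OF n z T]])
       (auto intro!: bounded_opD(1)[OF Fn_infD[OF T]] kernel_vec_in_l2[OF n z] d)
  ultimately show ?thesis by simp
qed

lemma Hinf_ballI_fun_calc:
  assumes n: "1 \<le> n" and f: "f \<in> Hinf" and T: "fun_calc n f \<in> Fn_ball n"
  shows "f \<in> Hinf_ball"
proof -
  have "cmod (f z) \<le> 1" if z: "cmod z < 1" for z
  proof -
    have z2: "(cmod z)\<^sup>2 < 1" using z by (simp add: abs_square_less_1)
    have "(cmod (f z))\<^sup>2 \<le> (l2norm (fun_calc n f (kernel_vec z)))\<^sup>2 * (1 - (cmod z)\<^sup>2)"
      by (rule fun_calc_kernel_estimate[OF n f z])
    also have "\<dots> \<le> (l2norm (kernel_vec z))\<^sup>2 * (1 - (cmod z)\<^sup>2)"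
      using Fn_ballD(3)[OF T kernel_vec_in_l2[OF n z]] z2
      by (intro mult_right_mono power_mono l2norm_nonneg) auto
    also have "\<dots> = 1" using z2 by (simp add: l2norm_kernel_vec[OF n z])
    finally show ?thesis by (simp add: power2_le_iff_abs_le abs_square_le_1)
  qed
  then show ?thesis using f by (auto simp: Hinf_ball_def)
qed

text \<open>The parallelogram law with weights. Being an identity, it makes the defect of an average
  exactly t(1 - t)|a - b|^2, which is the origin of the constant t(1 - t).\<close>

lemma cmod_convex_power2:
  "(1 - t) * (cmod a)\<^sup>2 + t * (cmod b)\<^sup>2
    = (cmod ((1 - complex_of_real t) * a + complex_of_real t * b))\<^sup>2 + t * (1 - t) * (cmod (a - b))\<^sup>2"
  unfolding cmod_power2 by (simp add: power2_eq_square algebra_simps)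

lemma l2norm_convex_power2:
  assumes A: "\<psi> \<in> l2 n" and B: "\<phi> \<in> l2 n"
  shows "(1 - t) * (l2norm \<psi>)\<^sup>2 + t * (l2norm \<phi>)\<^sup>2
    = (l2norm (\<lambda>w. (1 - complex_of_real t) * \<psi> w + complex_of_real t * \<phi> w))\<^sup>2
      + t * (1 - t) * (l2norm (\<lambda>w. \<psi> w - \<phi> w))\<^sup>2"
proof -
  have s: "(\<lambda>w. (cmod (\<xi> w))\<^sup>2) summable_on UNIV" if "\<xi> \<in> l2 n" for \<xi>
    using that by (simp add: l2_def)
  note cm = summable_on_cmult_right
  have "(1 - t) * (l2norm \<psi>)\<^sup>2 + t * (l2norm \<phi>)\<^sup>2
      = (\<Sum>\<^sub>\<infinity>w. (1 - t) * (cmod (\<psi> w))\<^sup>2 + t * (cmod (\<phi> w))\<^sup>2)"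
    unfolding l2norm_power2 infsum_cmult_right'[symmetric]
    by (intro infsum_add[symmetric] cm s A B)
  also have "\<dots> = (\<Sum>\<^sub>\<infinity>w. (cmod ((1 - complex_of_real t) * \<psi> w + complex_of_real t * \<phi> w))\<^sup>2
      + t * (1 - t) * (cmod (\<psi> w - \<phi> w))\<^sup>2)"
    by (simp only: cmod_convex_power2)
  also have "\<dots> = (l2norm (\<lambda>w. (1 - complex_of_real t) * \<psi> w + complex_of_real t * \<phi> w))\<^sup>2
      + t * (1 - t) * (l2norm (\<lambda>w. \<psi> w - \<phi> w))\<^sup>2"
    unfolding l2norm_power2 infsum_cmult_right'[symmetric]
    by (intro infsum_add cm s l2_add l2_smult l2_diff A B)
  finally show ?thesis .
qed

text \<open>The estimates for f and g use the same kernel vector k, so they add up inside the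
  weighted parallelogram law for A k and B k. Contractivity then bounds the total by |k|^2 (1 -
  |z|^2) = 1.\<close>

lemma fun_calc_convex_combination_bound:
  fixes A B :: op and t :: real
  assumes n: "1 \<le> n" and f: "f \<in> Hinf" and A: "A \<in> Fn_ball n" and B: "B \<in> Fn_ball n"
    and t: "0 < t" "t < 1"
    and eq: "fun_calc n f = (\<lambda>\<psi> w. (1 - complex_of_real t) * A \<psi> w + complex_of_real t * B \<psi> w)"
    and v: "v = [] \<or> last v \<noteq> 0" and z: "cmod z < 1"
  shows "(cmod (f z))\<^sup>2
    + t * (1 - t) * (cmod (\<Sum>j. (A (delta []) (v @ replicate j 0) - B (delta []) (v @ replicate j 0)) * z ^ j))\<^sup>2 \<le> 1"
    (is "_ + _ * (cmod ?g)\<^sup>2 \<le> 1")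
proof -
  let ?k = "kernel_vec z" and ?q = "1 - (cmod z)\<^sup>2"
  have q: "?q > 0" using z by (simp add: abs_square_less_1)
  have k: "?k \<in> l2 n" by (rule kernel_vec_in_l2[OF n z])
  have d: "delta [] \<in> l2 n" by (rule l2_delta) (simp add: words_def)
  let ?D = "\<lambda>\<psi> w. A \<psi> w - B \<psi> w"
  have g: "(cmod ?g)\<^sup>2 \<le> (l2norm (?D ?k))\<^sup>2 * ?q"
  proof (rule kernel_estimate[where n=n, OF z _ _ _ v])
    fix w
    show "?D ?k w = ?D (delta []) w + cnj z * right_creation 0 (?D ?k) w"
      using Fn_inf_kernel_vec[OF n z Fn_ballD(1)[OF A], of w] Fn_inf_kernel_vec[OF n z Fn_ballD(1)[OF B], of w]
      by (auto simp: right_creation_def algebra_simps)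
  qed (intro l2_diff Fn_ballD(2)[OF A] Fn_ballD(2)[OF B] k d)+
  have "(cmod (f z))\<^sup>2 + t * (1 - t) * (cmod ?g)\<^sup>2
      \<le> (l2norm (fun_calc n f ?k))\<^sup>2 * ?q + t * (1 - t) * ((l2norm (?D ?k))\<^sup>2 * ?q)"
    using t by (intro add_mono fun_calc_kernel_estimate[OF n f z] mult_left_mono g) auto
  also have "\<dots> = ((l2norm (fun_calc n f ?k))\<^sup>2 + t * (1 - t) * (l2norm (?D ?k))\<^sup>2) * ?q"
    by (simp add: algebra_simps)
  also have "(l2norm (fun_calc n f ?k))\<^sup>2 + t * (1 - t) * (l2norm (?D ?k))\<^sup>2
      = (1 - t) * (l2norm (A ?k))\<^sup>2 + t * (l2norm (B ?k))\<^sup>2"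
    by (subst l2norm_convex_power2[OF Fn_ballD(2)[OF A k] Fn_ballD(2)[OF B k]]) (simp add: eq)
  also have "((1 - t) * (l2norm (A ?k))\<^sup>2 + t * (l2norm (B ?k))\<^sup>2) * ?q
      \<le> ((1 - t) * (l2norm ?k)\<^sup>2 + t * (l2norm ?k)\<^sup>2) * ?q"
    using t q Fn_ballD(3)[OF A k] Fn_ballD(3)[OF B k]
    by (intro mult_right_mono add_mono mult_left_mono power_mono l2norm_nonneg) auto
  also have "\<dots> = (l2norm ?k)\<^sup>2 * ?q" by (simp add: algebra_simps)
  also have "\<dots> = 1" using q by (simp add: l2norm_kernel_vec[OF n z])
  finally show ?thesis .
qed

text \<open>If g(0) = 0, zeros of a nonzero power series are isolated, so a point close to 0 works;
  the minimum with 1/2 keeps it in the disc when the radius s is large.\<close>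

lemma power_series_nonzero:
  fixes a :: "nat \<Rightarrow> complex"
  assumes sums: "\<And>z. cmod z < 1 \<Longrightarrow> (\<lambda>j. a j * z ^ j) sums g z" and m: "a m \<noteq> 0"
  obtains z where "cmod z < 1" "g z \<noteq> 0"
proof (cases "g 0 = 0")
  case True
  have "a 0 = 0" using sums[of 0] True by (simp add: powser_sums_zero_iff)
  then have m0: "m > 0" using m by (cases m) auto
  obtain s where s: "0 < s" "\<And>z. z \<in> cball 0 s - {0} \<Longrightarrow> g z \<noteq> 0"
    using powser_0_nonzero[of 1 0 a g m] sums m m0 True by auto
  let ?z = "complex_of_real (min s (1/2))"
  have "?z \<in> cball 0 s - {0}" "cmod ?z < 1" using s(1) by (auto simp: min_def)
  then show ?thesis using s(2) that by blast
qed (use that[of 0] in auto)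

text \<open>Since \<open>2|f| \<le> 1 + |f|\<^sup>2\<close>, the hypothesis gives \<open>|f| + c|g|\<^sup>2/2 \<le> 1\<close>, so \<open>f \<plusminus> cg\<^sup>2/2\<close> stay in the
  ball.\<close>

lemma not_extreme_HinfI:
  assumes f: "f \<in> Hinf" and c: "c > 0"
    and sums: "\<And>z. cmod z < 1 \<Longrightarrow> (\<lambda>j. a j * z ^ j) sums g z" and m: "a m \<noteq> 0"
    and le: "\<And>z. cmod z < 1 \<Longrightarrow> (cmod (f z))\<^sup>2 + c * (cmod (g z))\<^sup>2 \<le> 1"
  shows "\<not> extreme_Hinf f"
proof -
  \<comment> \<open>The square makes h analytic with modulus c|g|^2/2; the value 0 off the disc is
    the normalisation required by \<open>Hinf\<close>.\<close>
  define h where "h z = (if cmod z < 1 then complex_of_real (c / 2) * (g z)\<^sup>2 else 0)" for z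
  have hol: "h holomorphic_on ball 0 1"
  proof -
    have "g holomorphic_on ball 0 1" by (rule power_series_holomorphic[where a=a]) (use sums in auto)
    then have "(\<lambda>z. complex_of_real (c / 2) * (g z)\<^sup>2) holomorphic_on ball 0 1"
      by (intro holomorphic_intros)
    then show ?thesis by (rule holomorphic_transform) (auto simp: h_def)
  qed
  have fh: "cmod (f z) + cmod (h z) \<le> 1" if z: "cmod z < 1" for z
  proof -
    have "cmod (h z) = c / 2 * (cmod (g z))\<^sup>2" using z c by (simp add: h_def norm_mult norm_power)
    moreover have "2 * cmod (f z) \<le> 1 + (cmod (f z))\<^sup>2"
      using sum_squares_bound[of "cmod (f z)" 1] by simp
    ultimately show ?thesis using le[OF z] by simp
  qed
  \<comment> \<open>Any unimodular s keeps f + s h in the ball; s = 1 and s = -1 give the ends of a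
    segment with midpoint f.\<close>
  have ball: "(\<lambda>z. f z + s * h z) \<in> Hinf_ball" if s: "cmod s = 1" for s
  proof -
    have le1: "cmod (f z + s * h z) \<le> 1" if "cmod z < 1" for z
      using norm_triangle_ineq[of "f z" "s * h z"] fh[OF that] s by (simp add: norm_mult)
    have "(\<lambda>z. f z + s * h z) holomorphic_on ball 0 1"
      using HinfD(2)[OF f] hol by (intro holomorphic_intros)
    moreover have "bounded ((\<lambda>z. f z + s * h z) ` ball 0 1)"
      using le1 by (auto simp: bounded_iff intro!: exI[of _ 1])
    ultimately show ?thesis using f le1 by (auto simp: Hinf_ball_def Hinf_def h_def)
  qed
  obtain z where z: "cmod z < 1" "g z \<noteq> 0" using power_series_nonzero[OF sums m] by blast
  have "h z \<noteq> 0" using z c by (simp add: h_def)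
  then have "f z + 1 * h z \<noteq> f z + - 1 * h z" by (simp add: eq_neg_iff_add_eq_0)
  then have ne: "(\<lambda>z. f z + 1 * h z) \<noteq> (\<lambda>z. f z + - 1 * h z)" by metis
  have mid: "f = (\<lambda>z. (1 - complex_of_real (1/2)) * (f z + 1 * h z) + complex_of_real (1/2) * (f z + - 1 * h z))"
    by (rule ext) (simp add: field_simps)
  show ?thesis
  proof
    assume "extreme_Hinf f"
    then have *: "g1 = g2" if "g1 \<in> Hinf_ball" "g2 \<in> Hinf_ball" "0 < t" "t < 1"
      "f = (\<lambda>z. (1 - complex_of_real t) * g1 z + complex_of_real t * g2 z)" for g1 g2 t
      using that unfolding extreme_Hinf_iff by blast
    have "(\<lambda>z. f z + 1 * h z) = (\<lambda>z. f z + - 1 * h z)"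
      by (rule *[OF ball ball _ _ mid]) auto
    with ne show False ..
  qed
qed

text \<open>Mirror image of the split by \<open>lead0\<close>: right creation by 0 lengthens the
  block of trailing zeros, so v selects the entry of the column and j the Taylor
  coefficient.\<close>

lemma word_split_trailing:
  obtains v j where "w = v @ replicate j (0::nat)" "v = [] \<or> last v \<noteq> 0"
proof -
  have "\<exists>v j. w = v @ replicate j (0::nat) \<and> (v = [] \<or> last v \<noteq> 0)"
  proof (induction w rule: rev_induct)
    case (snoc i w)
    then obtain v j where vj: "w = v @ replicate j 0" "v = [] \<or> last v \<noteq> 0" by blast
    show ?case
    proof (cases "i = 0")
      case True
      then have "w @ [i] = v @ replicate (Suc j) 0" using vj by (simp add: replicate_append_same)
      then show ?thesis using vj(2) by blast
    next
      case False
      then show ?thesis by (intro exI[of _ "w @ [i]"] exI[of _ 0]) simp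
    qed
  qed simp
  then show ?thesis using that by blast
qed

theorem mainTheorem11:
  fixes n :: nat and f :: "complex \<Rightarrow> complex"
  assumes "n \<ge> 1" and "f \<in> Hinf"
  shows "extreme_Hinf f \<longleftrightarrow> extreme_Fn n (fun_calc n f)"
proof
  assume ext: "extreme_Hinf f"
  then have "fun_calc n f \<in> Fn_ball n"
    using fun_calc_in_Fn_ball[OF assms(1)] by (simp add: extreme_Hinf_iff)
  moreover have False
    if A: "A \<in> Fn_ball n" and B: "B \<in> Fn_ball n" and t: "0 < t" "t < 1" and ne: "A \<noteq> B"
      and eq: "fun_calc n f = (\<lambda>\<psi> w. (1 - complex_of_real t) * A \<psi> w + complex_of_real t * B \<psi> w)" for A B t
  proof -
    let ?\<phi> = "\<lambda>w. A (delta []) w - B (delta []) w"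
    have d: "delta [] \<in> l2 n" by (rule l2_delta) (simp add: words_def)
    \<comment> \<open>Distinct A and B already differ on the vacuum, in some coordinate w. Writing w
      = v 0^m selects the column entry of v, whose m-th coefficient is then nonzero.\<close>
    obtain w where "?\<phi> w \<noteq> 0"
      using Fn_inf_eqI[OF Fn_ballD(1)[OF A] Fn_ballD(1)[OF B]] ne by (auto simp: fun_eq_iff)
    moreover obtain v m where "w = v @ replicate m 0" and v: "v = [] \<or> last v \<noteq> 0"
      by (rule word_split_trailing)
    ultimately have m: "?\<phi> (v @ replicate m 0) \<noteq> 0" by simp
    have \<phi>: "?\<phi> \<in> l2 n" by (intro l2_diff Fn_ballD(2)[OF A] Fn_ballD(2)[OF B] d)
    have "\<not> extreme_Hinf f"
    proof (rule not_extreme_HinfI[where a="\<lambda>j. ?\<phi> (v @ replicate j 0)" and c="t * (1 - t)"])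
      show "(\<lambda>j. ?\<phi> (v @ replicate j 0) * z ^ j) sums (\<Sum>j. ?\<phi> (v @ replicate j 0) * z ^ j)"
        if "cmod z < 1" for z
        by (intro summable_sums summable_norm_cancel[OF bounded_coeff_summable[OF l2_component_le[OF \<phi>] that]])
      show "(cmod (f z))\<^sup>2 + t * (1 - t) * (cmod (\<Sum>j. ?\<phi> (v @ replicate j 0) * z ^ j))\<^sup>2 \<le> 1"
        if "cmod z < 1" for z
        by (rule fun_calc_convex_combination_bound[OF assms A B t eq v that])
    qed (use assms(2) t m in auto)
    then show False using ext by simp
  qed
  ultimately show "extreme_Fn n (fun_calc n f)" unfolding extreme_Fn_iff by blast
next
  assume ext: "extreme_Fn n (fun_calc n f)"
  then have "f \<in> Hinf_ball"
    using Hinf_ballI_fun_calc[OF assms] by (simp add: extreme_Fn_iff)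
  moreover have False
    if g: "g \<in> Hinf_ball" and h: "h \<in> Hinf_ball" and t: "0 < t" "t < 1" and ne: "g \<noteq> h"
      and eq: "f = (\<lambda>z. (1 - complex_of_real t) * g z + complex_of_real t * h z)" for g h t
  proof -
    have gh: "g \<in> Hinf" "h \<in> Hinf" using g h by (auto simp: Hinf_ball_def)
    \<comment> \<open>The splitting of f is carried over to g(S_1) and h(S_1), which are
      contractions by von Neumann's inequality and distinct by injectivity.\<close>
    have "fun_calc n f = (\<lambda>\<psi> w. (1 - complex_of_real t) * fun_calc n g \<psi> w + complex_of_real t * fun_calc n h \<psi> w)"
      by (rule fun_calc_lincomb[OF assms gh eq])
    moreover have "fun_calc n g \<noteq> fun_calc n h" using fun_calc_inj[OF assms(1) gh] ne by blast
    ultimately show False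
      using ext t fun_calc_in_Fn_ball[OF assms(1) g] fun_calc_in_Fn_ball[OF assms(1) h]
      unfolding extreme_Fn_iff by blast
  qed
  ultimately show "extreme_Hinf f" unfolding extreme_Hinf_iff by blast
qed

end
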